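(* Let $\bar\alpha>0$, $\rho\in(0,1)$, $c_{\mathrm A}\in(0,1)$, $x^0\in\mathcal M^B$, and let $\{x^k\}_{k\ge0}$ be an (infinite) sequence of iterates generated by the Riemannian line-search method with backtracking described in the context, with initial step sizes $\bar\alpha_k=\min\{\bar\alpha,\Delta_{RL}\}$ for all $k\ge0$. Suppose that there is a constant $K_a>0$ such that the search directions $d^k$ (unit norm) satisfy, for all $k\ge0$, $$\bigl(d^k,\operatorname{grad}J^B(x^k)\bigr)_{x^k}\ge K_a\|\operatorname{grad}J^B(x^k)\|_{x^k}.$$ Then $$\lim_{k\to+\infty}\|\operatorname{grad}J^B(x^k)\|_{\mathcal E}=0 .$$
   Context: $\mathcal E,\mathcal Y$ are real Hilbert spaces, $\mathcal Y\neq\{0\}$. $\mathcal M\subset\mathcal E$ is a $C^2$ embedded submanifold; for $x\in\mathcal M$ the tangent space $T_x\mathcal M$ is identified with a closed linear subspace of $\mathcal E$. $B:\mathcal E\to\mathcal Y$ is a surjective bounded linear operator with adjoint $B^*$, $c\in\mathcal Y$, and $\mathcal M^B:=\{x\in\mathcal M: Bx=c\}$ is nonempty. For each $x\in\mathcal M$ a bounded linear projection $P_x:\mathcal E\to T_x\mathcal M$ onto $T_x\mathcal M$ is given (not necessarily orthogonal), and $L_x:=BP_xB^*$. For each $x\in\mathcal M$ a $C^2$ map $R_x:T_x\mathcal M\to\mathcal M$ is given with $R_x(0)=x$, $DR_x(0)=\mathrm{Id}$, and $x\mapsto D^2R_x(0)$ is bounded on bounded subsets of $\mathcal M$. Standing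 assumptions: (A1) for every bounded $S\subset\mathcal M^B$ there is $C_S>0$ with $(L_x\delta,\delta)_{\mathcal Y}\ge C_S\|\delta\|_{\mathcal Y}^2$ for all $x\in S$, $\delta\in\mathcal Y$; (A2) $x\mapsto P_x\in\mathcal L(\mathcal E,\mathcal E)$ is continuous on $\mathcal M$ and maps bounded sets to bounded sets; (A3) for every bounded $S\subset\mathcal M$ there are $\sigma,K_1,K_2>0$ such that $\|DR_x(u)\|\le K_1$ and $\|D^2R_x(u)\|\le K_2$ for all $x\in S$, $u\in T_x\mathcal M$ with $\|u\|_{\mathcal E}\le\sigma$. Under (A1), $L_x$ is invertible and $\mathcal M^B$ is a $C^2$ Hilbert submanifold with $T_x\mathcal M^B=T_x\mathcal M\cap\ker B$ and ambient metric $(u,v)_x=(u,v)_{\mathcal E}$, norm $\|\cdot\|_x$. Objective: $J:\mathcal E\to\mathbb R$ is $C^2$, bounded from below, coercive (bounded sublevel sets), with $\operatorname{grad}J$ and $\operatorname{Hess}J$ mapping bounded sets to bounded sets. $J^B:=J|_{\mathcal M^B}$, with Riemannian gradient $\operatorname{grad}J^B(x)\in T_x\mathcal M^B$ for $(\cdot,\cdot)_x$. Let $X:=\{x\in\mathcal M^B: J^B(x)\le J^B(x^0)\}$, a bounded set. Constants for $X$: $\|P_x\|\le K_P$, $\|L_x^{-1}\|\le K_L$ on $X$; $\sigma,K_1,K_2$ as in (A3) with $S=X$; $$r:=\min\Bigl\{\tfrac{\sigma}{2K_P\|B\|},\tfrac{1}{4K_2K_LK_P^2\|B\|^3}\Bigr\},\qquad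 \Delta_s:=\min\Bigl\{\tfrac{\sigma}{2},\tfrac{1}{4K_2K_LK_P\|B\|^2},\tfrac{r}{2K_1K_L\|B\|}\Bigr\}.$$ For $x\in X$, $v\in T_x\mathcal M^B$ with $\|v\|_x<\Delta_s$, $\delta_x(v)$ is the unique $\delta\in\mathcal Y$ with $\|\delta\|_{\mathcal Y}\le r$ and $BR_x(v-P_xB^*\delta)=c$ ($\delta_x$ is $C^2$, $\delta_x(0)=0$); $R_x^B(v):=R_x(v-P_xB^*\delta_x(v))\in\mathcal M^B$ and $J_x^B(v):=J^B(R_x^B(v))$. The constants $0<\Delta_{RL}<\Delta_s$ and $\beta_{RL}>0$ are such that $|\frac{d}{ds}J_x^B(s\xi)|_{s=t}-\frac{d}{ds}J_x^B(s\xi)|_{s=0}|\le\beta_{RL}t$ for all $x\in X$, unit $\xi\in T_x\mathcal M^B$, $t\in[0,\Delta_{RL}]$ (such constants exist). Riemannian line-search method: for each $k\ge0$, select $d^k\in T_{x^k}\mathcal M^B$ with $\|d^k\|_{x^k}=1$ such that $-d^k$ is a descent direction (i.e. $(\operatorname{grad}J^B(x^k),d^k)_{x^k}>0$); set $\bar\alpha_k=\min\{\bar\alpha,\Delta_{RL}\}$; let $\alpha_k=\bar\alpha_k\rho^j$ with the smallest integer $j\ge0$ for which the Armijo condition $$J^B\bigl(R_{x^k}^B(-\alpha_kd^k)\bigr)\le J^B(x^k)-c_{\mathrm A}\alpha_k\bigl(\operatorname{grad}J^B(x^k),d^k\bigr)_{x^k}$$ holds; set $x^{k+1}=R_{x^k}^B(-\alpha_kd^k)$.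 *)

theory Defs
  imports "HOL-Analysis.Analysis"
begin

(* Real Hilbert spaces are types of sort {real_inner, banach}. *)

section \<open>Maps of class \<open>C\<^sup>2\<close>\<close>

(* S is always an open set or a closed linear subspace T.  In the second case the values of f' and
   f'' are determined on arguments from T only.  Asking for operators on the whole space is no
   restriction: a derivative defined on T extends by composition with the orthogonal projection
   onto T, which preserves norms and continuity. *)
definition has_C2_derivs ::
  "'a::real_normed_vector set \<Rightarrow> ('a \<Rightarrow> 'b::real_normed_vector)
    \<Rightarrow> ('a \<Rightarrow> 'a \<Rightarrow>\<^sub>L 'b) \<Rightarrow> ('a \<Rightarrow> 'a \<Rightarrow>\<^sub>L 'a \<Rightarrow>\<^sub>L 'b) \<Rightarrow> bool" where
  "has_C2_derivs S f f' f'' \<longleftrightarrow>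
     (\<forall>x\<in>S. (f has_derivative blinfun_apply (f' x)) (at x within S)) \<and>
     (\<forall>x\<in>S. (f' has_derivative blinfun_apply (f'' x)) (at x within S)) \<and>
     continuous_on S f''"

definition C2_on :: "'a::real_normed_vector set \<Rightarrow> ('a \<Rightarrow> 'b::real_normed_vector) \<Rightarrow> bool" where
  "C2_on S f \<longleftrightarrow> (\<exists>f' f''. has_C2_derivs S f f' f'')"

definition gradient :: "('a::real_inner \<Rightarrow> real) \<Rightarrow> 'a \<Rightarrow> 'a" where
  "gradient f x = (THE g. GDERIV f x :> g)"

definition hessian :: "('a::real_inner \<Rightarrow> real) \<Rightarrow> 'a \<Rightarrow> 'a \<Rightarrow>\<^sub>L 'a" where
  "hessian f x = (THE H. (gradient f has_derivative blinfun_apply H) (at x))"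


section \<open>Embedded submanifolds\<close>

(* Slice charts.  Closed subspaces of a Hilbert space are complemented, so no separate splitting
   condition on F is needed. *)
definition C2_embedded_submanifold :: "'a::{real_inner,banach} set \<Rightarrow> bool" where
  "C2_embedded_submanifold M \<longleftrightarrow>
     (\<forall>x\<in>M. \<exists>U (V :: 'a set) \<phi> \<psi> F.
        open U \<and> x \<in> U \<and> open V \<and> homeomorphism U V \<phi> \<psi> \<and> C2_on U \<phi> \<and> C2_on V \<psi> \<and>
        subspace F \<and> closed F \<and> \<phi> ` (U \<inter> M) = V \<inter> F)"

(* \<gamma> is, near 0, a C^1 curve in S through x with velocity v. *)
definition curve_through ::
  "'a::real_normed_vector set \<Rightarrow> 'a \<Rightarrow> (real \<Rightarrow> 'a) \<Rightarrow> 'a \<Rightarrow> bool" where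
  "curve_through S x \<gamma> v \<longleftrightarrow>
     (\<exists>\<epsilon>>0. \<exists>\<gamma>'. \<gamma> ` {-\<epsilon><..<\<epsilon>} \<subseteq> S \<and>
        (\<forall>t\<in>{-\<epsilon><..<\<epsilon>}. (\<gamma> has_vector_derivative \<gamma>' t) (at t)) \<and>
        continuous_on {-\<epsilon><..<\<epsilon>} \<gamma>' \<and> \<gamma> 0 = x \<and> \<gamma>' 0 = v)"

definition tangent_space :: "'a::real_normed_vector set \<Rightarrow> 'a \<Rightarrow> 'a set" where
  "tangent_space S x = {v. \<exists>\<gamma>. curve_through S x \<gamma> v}"

(* Gradient of the restriction of f to the submanifold N with the ambient metric: the tangent
   vector representing the differential d/dt f(\<gamma>(t)) at t = 0. *)
definition riemannian_gradient :: "'a::real_inner set \<Rightarrow> ('a \<Rightarrow> real) \<Rightarrow> 'a \<Rightarrow> 'a" where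
  "riemannian_gradient N f x =
     (THE g. g \<in> tangent_space N x \<and>
        (\<forall>\<gamma> v. curve_through N x \<gamma> v \<longrightarrow>
           ((\<lambda>t. f (\<gamma> t)) has_real_derivative (g \<bullet> v)) (at 0)))"


section \<open>The constrained retraction\<close>

definition L_op ::
  "('e::real_inner \<Rightarrow>\<^sub>L 'y::real_inner) \<Rightarrow> ('e \<Rightarrow> 'e \<Rightarrow>\<^sub>L 'e) \<Rightarrow> 'e \<Rightarrow> 'y \<Rightarrow> 'y" where
  "L_op B P x \<delta> = B (P x (adjoint B \<delta>))"

definition correction ::
  "('e::real_inner \<Rightarrow>\<^sub>L 'y::real_inner) \<Rightarrow> 'y \<Rightarrow> ('e \<Rightarrow> 'e \<Rightarrow>\<^sub>L 'e) \<Rightarrow> ('e \<Rightarrow> 'e \<Rightarrow> 'e) \<Rightarrow> real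
    \<Rightarrow> 'e \<Rightarrow> 'e \<Rightarrow> 'y" where
  "correction B c P R r x v =
     (THE \<delta>. norm \<delta> \<le> r \<and> B (R x (v - P x (adjoint B \<delta>))) = c)"

definition constrained_retraction ::
  "('e::real_inner \<Rightarrow>\<^sub>L 'y::real_inner) \<Rightarrow> 'y \<Rightarrow> ('e \<Rightarrow> 'e \<Rightarrow>\<^sub>L 'e) \<Rightarrow> ('e \<Rightarrow> 'e \<Rightarrow> 'e) \<Rightarrow> real
    \<Rightarrow> 'e \<Rightarrow> 'e \<Rightarrow> 'e" where
  "constrained_retraction B c P R r x v =
     R x (v - P x (adjoint B (correction B c P R r x v)))"

(* Operator norms are those of maps on the tangent space, hence the restriction to tangent
   vectors w. *)
definition retraction_bounds ::
  "'e::real_normed_vector set \<Rightarrow> ('e \<Rightarrow> 'e \<Rightarrow> 'e \<Rightarrow>\<^sub>L 'e) \<Rightarrow> ('e \<Rightarrow> 'e \<Rightarrow> 'e \<Rightarrow>\<^sub>L 'e \<Rightarrow>\<^sub>L 'e)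
    \<Rightarrow> 'e set \<Rightarrow> real \<Rightarrow> real \<Rightarrow> real \<Rightarrow> bool" where
  "retraction_bounds M DR D2R S \<sigma> K1 K2 \<longleftrightarrow>
     \<sigma> > 0 \<and> K1 > 0 \<and> K2 > 0 \<and>
     (\<forall>x\<in>S. \<forall>u\<in>tangent_space M x. norm u \<le> \<sigma> \<longrightarrow>
        (\<forall>w\<in>tangent_space M x. norm (DR x u w) \<le> K1 * norm w) \<and>
        (\<forall>w1\<in>tangent_space M x. \<forall>w2\<in>tangent_space M x.
           norm (D2R x u w1 w2) \<le> K2 * norm w1 * norm w2))"


section \<open>Riemannian line search\<close>

definition armijo ::
  "'e::real_inner set \<Rightarrow> ('e \<Rightarrow> real) \<Rightarrow> ('e \<Rightarrow> 'e \<Rightarrow> 'e) \<Rightarrow> real \<Rightarrow> 'e \<Rightarrow> 'e \<Rightarrow> real \<Rightarrow> bool" where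
  "armijo N f ret cA x d \<alpha> \<longleftrightarrow>
     f (ret x (- (\<alpha> *\<^sub>R d))) \<le> f x - cA * \<alpha> * (riemannian_gradient N f x \<bullet> d)"

definition line_search_iterates ::
  "'e::real_inner set \<Rightarrow> ('e \<Rightarrow> real) \<Rightarrow> ('e \<Rightarrow> 'e \<Rightarrow> 'e) \<Rightarrow> (nat \<Rightarrow> real) \<Rightarrow> real \<Rightarrow> real
    \<Rightarrow> 'e \<Rightarrow> (nat \<Rightarrow> 'e) \<Rightarrow> (nat \<Rightarrow> 'e) \<Rightarrow> bool" where
  "line_search_iterates N f ret abar \<rho> cA x0 x d \<longleftrightarrow>
     x 0 = x0 \<and>
     (\<forall>k. d k \<in> tangent_space N (x k) \<and> norm (d k) = 1 \<and>
        riemannian_gradient N f (x k) \<bullet> d k > 0 \<and>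
        (\<exists>j. armijo N f ret cA (x k) (d k) (abar k * \<rho> ^ j) \<and>
             (\<forall>i<j. \<not> armijo N f ret cA (x k) (d k) (abar k * \<rho> ^ i)) \<and>
             x (Suc k) = ret (x k) (- ((abar k * \<rho> ^ j) *\<^sub>R d k))))"

end

theory Submission
  imports Defs
begin

text \<open>A line search with backtracking drives \<open>m\<^sub>k = (grad J\<^sup>B(x\<^sup>k), d\<^sup>k)\<close> to zero because a step
\<open>\<alpha>\<^sub>k\<close> lowers \<open>J\<close> by at least \<open>c\<^sub>A \<alpha>\<^sub>k m\<^sub>k\<close>, while \<open>J\<close> is bounded below and \<open>\<alpha>\<^sub>k\<close> cannot be much smaller
than \<open>m\<^sub>k\<close>.  Indeed, by the mean value theorem the pullback \<open>\<phi>(s) = J(R\<^sup>B(-s d\<^sup>k))\<close> satisfies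
\<open>\<phi>(\<alpha>) - \<phi>(0) = \<alpha> \<phi>'(\<tau>)\<close> with \<open>0 < \<tau> < \<alpha>\<close>, and \<open>\<phi>'(\<tau>) \<le> \<phi>'(0) + \<beta> \<alpha>\<close>; since \<open>\<phi>'(0) = - m\<^sub>k\<close>, every
trial step up to \<open>(1 - c\<^sub>A) m\<^sub>k / \<beta>\<close> passes the Armijo test.  Backtracking therefore stops with
\<open>\<alpha>\<^sub>k \<ge> min {a, \<rho> (1 - c\<^sub>A) m\<^sub>k / \<beta>}\<close>, where \<open>a\<close> is the initial step, and \<open>\<alpha>\<^sub>k m\<^sub>k \<longlonglongrightarrow> 0\<close> forces \<open>m\<^sub>k \<longlonglongrightarrow> 0\<close>.
The angle condition turns this into convergence of the gradients.  These are
\<open>sufficient_decrease_for_small_steps\<close>, \<open>backtracked_step_lower_bound\<close> and \<open>slopes_tendsto_0\<close>.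

The remaining work is to show that \<open>\<phi>\<close> really is differentiable with \<open>\<phi>'(0) = - m\<^sub>k\<close>.  This is not
immediate: the constrained retraction, its correction term and the Riemannian gradient are all
given by descriptions, which say nothing until existence and uniqueness are known.

At a fixed point \<open>z\<close> write \<open>R(u) = z + u + N(u)\<close>.  As \<open>D R(0)\<close> is the identity and \<open>D\<^sup>2 R\<close> is bounded
by \<open>K\<^sub>2\<close>, the remainder \<open>N\<close> has Lipschitz constant at most \<open>K\<^sub>2 \<varrho>\<close> on tangent vectors of norm at most \<open>\<varrho>\<close>.
For \<open>v\<close> in the kernel of \<open>B\<close> the constraint \<open>B R(v - P B\<^sup>* \<delta>) = c\<close> becomes \<open>L \<delta> = B N(v - P B\<^sup>* \<delta>)\<close>, where
\<open>L = B P B\<^sup>*\<close> is invertible because it is coercive.  The radii \<open>r\<close> and \<open>\<Delta>\<^sub>s\<close> are chosen so that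
\<open>\<delta> \<mapsto> L\<^sup>-\<^sup>1 B N(v - P B\<^sup>* \<delta>)\<close> maps the ball of radius \<open>r\<close> into itself and contracts distances by
\<open>1/2\<close>; hence the correction exists and is unique (\<open>correction_exists_unique\<close>).  A fixed point of
contractions that depend on a parameter in a \<open>C\<^sup>1\<close> way is \<open>C\<^sup>1\<close> in the parameter
(\<open>fixed_point_of_C1_contractions_is_C1\<close>), so \<open>t \<mapsto> R\<^sup>B(t v)\<close> is a \<open>C\<^sup>1\<close> curve in the constraint set with
velocity \<open>v\<close> at \<open>0\<close> (\<open>RB_ray_C1\<close>).

These curves show that every tangent vector of \<open>M\<close> in the kernel of \<open>B\<close> is tangent to the constraint
set (\<open>tangent_space_constraint_set\<close>); the tangent space is therefore a closed subspace, the Riemannian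
gradient exists by the Riesz representation theorem, and its inner product with \<open>\<xi>\<close> is the
derivative of \<open>J(R\<^sup>B(s \<xi>))\<close> at \<open>s = 0\<close> (\<open>deriv_pullback_0\<close>).\<close>

section \<open>Linear functionals and coercive operators on Hilbert spaces\<close>

text \<open>The representing vector minimises \<open>q(v) = (v, v) - 2 f(v)\<close> over the subspace: by the parallelogram
law minimising sequences are Cauchy, and the vanishing derivative of \<open>q\<close> at the minimiser is the
assertion.  Allowing a proper subspace serves two purposes: the whole space yields the adjoint of an
operator, and a tangent space yields a Riemannian gradient.\<close>

lemma riesz_representation_on_closed_subspace:
  fixes S :: "'a::{real_inner,banach} set"
  assumes S: "subspace S" "closed S" and f: "bounded_linear f"
  obtains g where "g \<in> S" "\<And>v. v \<in> S \<Longrightarrow> g \<bullet> v = f v"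
proof -
  interpret f: bounded_linear f by (rule f)
  define q where "q v = v \<bullet> v - 2 * f v" for v
  define m where "m = Inf (q ` S)"
  obtain K where K: "\<And>v. norm (f v) \<le> norm v * K" using f.bounded by blast
  have q_ge: "q v \<ge> - K\<^sup>2" for v
  proof -
    have "f v \<le> norm v * K" using K[of v] by simp
    moreover have "0 \<le> (norm v - K)\<^sup>2" by simp
    ultimately show ?thesis
      by (simp add: q_def power2_diff power2_norm_eq_inner[symmetric])
  qed
  have bdd: "bdd_below (q ` S)" using q_ge by (intro bdd_belowI2)
  have "0 \<in> S" using S subspace_0 by blast
  then have ne: "q ` S \<noteq> {}" by blast
  have m_le: "m \<le> q v" if "v \<in> S" for v
    unfolding m_def using bdd that by (intro cINF_lower)
  have "\<exists>v\<in>S. q v < m + 1 / Suc n" for n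
    using cInf_lessD[OF ne, of "m + 1 / Suc n"] unfolding m_def by fastforce
  then obtain s where s: "\<And>n. s n \<in> S" "\<And>n. q (s n) < m + 1 / Suc n" by metis
  \<comment> \<open>The parallelogram law, with the midpoint of \<open>a\<close> and \<open>b\<close> as competitor.\<close>
  have close: "(norm (a - b))\<^sup>2 \<le> 2 * (q a + q b - 2 * m)" if "a \<in> S" "b \<in> S" for a b
  proof -
    have "(1/2) *\<^sub>R (a + b) \<in> S" using that S by (simp add: subspace_add subspace_mul)
    from m_le[OF this] show ?thesis
      by (simp add: q_def f.scaleR f.add power2_norm_eq_inner inner_add inner_diff inner_commute
          algebra_simps)
  qed
  have "Cauchy s"
  proof (rule metric_CauchyI)
    fix e :: real assume "e > 0"
    then obtain n0 :: nat where n0: "1 / Suc n0 < e\<^sup>2 / 4"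
      using nat_approx_posE[of "e\<^sup>2/4"] by auto
    have "dist (s i) (s j) < e" if "i \<ge> n0" "j \<ge> n0" for i j
    proof -
      have "1 / Suc i \<le> 1 / Suc n0" "1 / Suc j \<le> 1 / Suc n0"
        using that by (auto intro!: divide_left_mono)
      then have "(norm (s i - s j))\<^sup>2 < e\<^sup>2"
        using close[OF s(1)[of i] s(1)[of j]] s(2)[of i] s(2)[of j] n0 by simp
      then show ?thesis using \<open>e > 0\<close> by (simp add: dist_norm power2_less_imp_less)
    qed
    then show "\<exists>M. \<forall>i\<ge>M. \<forall>j\<ge>M. dist (s i) (s j) < e" by blast
  qed
  then obtain g where g: "s \<longlonglongrightarrow> g" using Cauchy_convergent_iff convergent_def by blast
  have "g \<in> S" using S(2) g s(1) closed_sequentially by blast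
  have "(\<lambda>n. q (s n)) \<longlonglongrightarrow> q g"
    unfolding q_def by (intro tendsto_intros g f.tendsto)
  moreover have "(\<lambda>n. m + 1 / Suc n) \<longlonglongrightarrow> m + 0"
    by (intro tendsto_intros LIMSEQ_inverse_real_of_nat[unfolded inverse_eq_divide])
  ultimately have "q g \<le> m + 0"
    by (rule LIMSEQ_le) (use s(2) less_imp_le in blast)
  then have min: "q g \<le> q v" if "v \<in> S" for v using m_le[OF that] by simp
  have "g \<bullet> v = f v" if v: "v \<in> S" for v
  proof -
    define D where "D = g \<bullet> v - f v"
    have quad: "0 \<le> 2 * t * D + t\<^sup>2 * (v \<bullet> v)" for t
    proof -
      have "g + t *\<^sub>R v \<in> S" using v \<open>g \<in> S\<close> S by (simp add: subspace_add subspace_mul)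
      from min[OF this] show ?thesis
        by (simp add: q_def D_def f.add f.scaleR inner_add inner_commute power2_eq_square
            algebra_simps)
    qed
    have "D = 0"
    proof (cases "v \<bullet> v = 0")
      case True
      then show ?thesis using quad[of "1"] quad[of "-1"] by simp
    next
      case False
      then have "v \<bullet> v > 0" by (metis inner_ge_zero less_eq_real_def)
      \<comment> \<open>The minimiser of the quadratic in \<open>t\<close>.\<close>
      with quad[of "- D / (v \<bullet> v)"] have "D\<^sup>2 \<le> 0"
        by (simp add: field_simps power2_eq_square)
      then show ?thesis by simp
    qed
    then show ?thesis by (simp add: D_def)
  qed
  with \<open>g \<in> S\<close> show ?thesis using that by blast
qed

text \<open>The adjoint is defined by choosing a function with the adjoint property, so this property holds only
because the Riesz theorem provides such a function.\<close>

lemma inner_adjoint_Hilbert: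
  fixes B :: "'a::{real_inner,banach} \<Rightarrow>\<^sub>L 'b::real_inner"
  shows "v \<bullet> adjoint B y = B v \<bullet> y"
proof -
  have "\<exists>w. \<forall>v. v \<bullet> w = B v \<bullet> y" for y
  proof -
    have lin: "bounded_linear (\<lambda>v. B v \<bullet> y)"
      by (intro bounded_linear_compose[OF bounded_linear_inner_left] blinfun.bounded_linear_right)
    obtain w where "\<And>v. w \<bullet> v = B v \<bullet> y"
      using riesz_representation_on_closed_subspace[OF subspace_UNIV closed_UNIV lin] by auto
    then show ?thesis by (metis inner_commute)
  qed
  then obtain f' where "\<forall>v y. B v \<bullet> y = v \<bullet> f' y" by metis
  note * = someI[of "\<lambda>f'. \<forall>v y. B v \<bullet> y = v \<bullet> f' y", OF this]
  show ?thesis unfolding adjoint_def by (rule *[rule_format, symmetric])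
qed

lemma norm_adjoint_Hilbert_le:
  fixes B :: "'a::{real_inner,banach} \<Rightarrow>\<^sub>L 'b::real_inner"
  shows "norm (adjoint B y) \<le> norm B * norm y"
proof (cases "adjoint B y = 0")
  case False
  have "(norm (adjoint B y))\<^sup>2 = B (adjoint B y) \<bullet> y"
    by (simp add: power2_norm_eq_inner inner_adjoint_Hilbert)
  also have "\<dots> \<le> norm (B (adjoint B y)) * norm y" by (rule norm_cauchy_schwarz)
  also have "\<dots> \<le> (norm B * norm (adjoint B y)) * norm y"
    by (intro mult_right_mono norm_blinfun) auto
  finally show ?thesis using False by (simp add: power2_eq_square)
qed simp

lemma bounded_linear_adjoint_Hilbert:
  fixes B :: "'a::{real_inner,banach} \<Rightarrow>\<^sub>L 'b::real_inner"
  shows "bounded_linear (adjoint B)"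
proof (rule bounded_linear_intro)
  show "adjoint B (x + y) = adjoint B x + adjoint B y" for x y
    by (rule vector_eq_ldot[THEN iffD1]) (simp add: inner_adjoint_Hilbert inner_add)
  show "adjoint B (a *\<^sub>R x) = a *\<^sub>R adjoint B x" for a x
    by (rule vector_eq_ldot[THEN iffD1]) (simp add: inner_adjoint_Hilbert)
  show "norm (adjoint B y) \<le> norm y * norm B" for y
    using norm_adjoint_Hilbert_le[of B y] by (simp add: mult.commute)
qed

text \<open>The Lax-Milgram theorem.  Surjectivity comes from Banach's fixed point theorem: for \<open>s = C / K\<^sup>2\<close>, with
\<open>K\<close> a bound for \<open>L\<close>, coercivity makes \<open>v \<mapsto> v - s (L v - y)\<close> a contraction, whose fixed point solves
\<open>L v = y\<close>.\<close>

lemma coercive_operator_invertible: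
  fixes L :: "'a::{real_inner,banach} \<Rightarrow> 'a"
  assumes L: "bounded_linear L" and C: "C > 0" "\<And>v. L v \<bullet> v \<ge> C * (norm v)\<^sup>2"
  shows "bij L" and "bounded_linear (inv L)"
proof -
  interpret L: bounded_linear L by (rule L)
  have lower: "C * norm v \<le> norm (L v)" for v
  proof (cases "v = 0")
    case False
    have "C * (norm v)\<^sup>2 \<le> norm (L v) * norm v"
      using C(2)[of v] norm_cauchy_schwarz[of "L v" v] by linarith
    then show ?thesis using False by (simp add: power2_eq_square)
  qed simp
  have "inj L"
  proof (rule injI)
    fix v w assume "L v = L w"
    then have "C * norm (v - w) \<le> 0" using lower[of "v - w"] by (simp add: L.diff)
    then show "v = w" using C(1) by (simp add: mult_le_0_iff)
  qed
  obtain K where K: "K > 0" "\<And>v. norm (L v) \<le> norm v * K" using L.pos_bounded by blast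
  \<comment> \<open>The bound is enlarged so that \<open>C \<le> K'\<close>, which keeps the radicand of \<open>q\<close> nonnegative.\<close>
  define K' where "K' = max K C"
  have K': "K' > 0" "C \<le> K'" "norm (L v) \<le> norm v * K'" for v
    using K(1) mult_left_mono[of K K' "norm v"] K(2)[of v] by (auto simp: K'_def)
  define s where "s = C / K'\<^sup>2"
  define q where "q = sqrt (1 - C\<^sup>2 / K'\<^sup>2)"
  have q2: "0 \<le> 1 - C\<^sup>2 / K'\<^sup>2" "1 - C\<^sup>2 / K'\<^sup>2 < 1"
    using C(1) K'(1,2) by (auto simp: power_mono)
  have q: "0 \<le> q" "q < 1" "q\<^sup>2 = 1 - C\<^sup>2 / K'\<^sup>2" using q2 by (auto simp: q_def)
  have contr: "norm (v - s *\<^sub>R L v) \<le> q * norm v" for v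
  proof (rule power2_le_imp_le)
    have "(norm (v - s *\<^sub>R L v))\<^sup>2 = (norm v)\<^sup>2 - 2 * s * (L v \<bullet> v) + s\<^sup>2 * (norm (L v))\<^sup>2"
      unfolding power2_norm_eq_inner
      by (simp add: inner_diff inner_commute[of v "L v"] power2_eq_square algebra_simps)
    also have "\<dots> \<le> (norm v)\<^sup>2 - 2 * s * (C * (norm v)\<^sup>2) + s\<^sup>2 * (norm v * K')\<^sup>2"
      using C K' by (intro add_mono diff_mono mult_left_mono power_mono) (auto simp: s_def)
    also have "\<dots> = q\<^sup>2 * (norm v)\<^sup>2"
    proof -
      have "s * (C * (norm v)\<^sup>2) = C\<^sup>2 / K'\<^sup>2 * (norm v)\<^sup>2"
        by (simp add: s_def power2_eq_square)
      moreover have "s\<^sup>2 * (norm v * K')\<^sup>2 = C\<^sup>2 / K'\<^sup>2 * (norm v)\<^sup>2"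
        using K'(1) by (simp add: s_def power_mult_distrib power_divide power2_eq_square)
      ultimately show ?thesis unfolding q(3) by (simp add: algebra_simps)
    qed
    finally show "(norm (v - s *\<^sub>R L v))\<^sup>2 \<le> (q * norm v)\<^sup>2" by (simp add: power_mult_distrib)
  qed (use q in simp)
  have "\<exists>v. L v = y" for y
  proof -
    have "\<exists>!v\<in>UNIV. v - s *\<^sub>R (L v - y) = v"
    proof (rule Banach_fix)
      show "complete (UNIV::'a set)" by (rule complete_UNIV)
      show "dist (v - s *\<^sub>R (L v - y)) (w - s *\<^sub>R (L w - y)) \<le> q * dist v w" for v w
        using contr[of "v - w"] by (simp add: dist_norm L.diff algebra_simps)
    qed (use q in auto)
    then obtain v where "v - s *\<^sub>R (L v - y) = v" by blast
    then have "s *\<^sub>R (L v - y) = 0" by simp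
    then show ?thesis using C(1) K'(1) by (auto simp: s_def)
  qed
  with \<open>inj L\<close> show bij: "bij L" by (metis bijI surjI surj_def)
  have inv: "L (inv L y) = y" for y using bij by (meson bij_inv_eq_iff)
  show "bounded_linear (inv L)"
  proof (rule bounded_linear_intro)
    show "inv L (x + y) = inv L x + inv L y" for x y
      by (rule injD[OF \<open>inj L\<close>]) (simp add: L.add inv)
    show "inv L (a *\<^sub>R x) = a *\<^sub>R inv L x" for a x
      by (rule injD[OF \<open>inj L\<close>]) (simp add: L.scaleR inv)
    show "norm (inv L y) \<le> norm y * (1 / C)" for y
      using lower[of "inv L y"] C(1) by (simp add: inv field_simps)
  qed
qed

section \<open>Fixed points of parametrised contractions\<close>

text \<open>Differentiating \<open>\<delta>(t) = h(t, \<delta>(t))\<close> formally gives \<open>\<delta>' = a + E \<delta>'\<close>, which has a unique solution as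
\<open>\<parallel>E\<parallel> \<le> q < 1\<close>.  That this solution is the derivative, and that it is continuous, follows in both cases
by absorption: a vector \<open>v = w + E v\<close> obeys \<open>(1 - q) \<parallel>v\<parallel> \<le> \<parallel>w\<parallel>\<close>, applied to the remainder of the
linear approximation and to increments of \<open>\<delta>'\<close>.  The Lipschitz bound on \<open>\<delta>\<close> turns the remainder of
\<open>h\<close>, small relative to \<open>\<bar>s - t\<bar> + \<parallel>\<delta>(s) - \<delta>(t)\<parallel>\<close>, into one that is small relative to \<open>\<bar>s - t\<bar>\<close>.\<close>

lemma fixed_point_of_C1_contractions_is_C1:
  fixes h :: "real \<times> 'b::banach \<Rightarrow> 'b" and E :: "real \<Rightarrow> 'b \<Rightarrow>\<^sub>L 'b"
  assumes I: "open I"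
    and fixed: "\<And>t. t \<in> I \<Longrightarrow> h (t, \<delta> t) = \<delta> t"
    and deriv: "\<And>t. t \<in> I \<Longrightarrow>
      (h has_derivative (\<lambda>p. fst p *\<^sub>R a t + E t (snd p))) (at (t, \<delta> t))"
    and q: "q < 1" "\<And>t. t \<in> I \<Longrightarrow> norm (E t) \<le> q"
    and lip: "\<And>s t. s \<in> I \<Longrightarrow> t \<in> I \<Longrightarrow> norm (\<delta> s - \<delta> t) \<le> K * \<bar>s - t\<bar>"
    and cont: "continuous_on I a" "continuous_on I E"
  obtains \<delta>' where "\<And>t. t \<in> I \<Longrightarrow> (\<delta> has_vector_derivative \<delta>' t) (at t)"
    "continuous_on I \<delta>'" "\<And>t. t \<in> I \<Longrightarrow> \<delta>' t = a t + E t (\<delta>' t)"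
proof -
  have absorb: "(1 - q) * norm v \<le> norm w" if "t \<in> I" "v = w + E t v" for t v w
  proof -
    have "norm v \<le> norm w + norm (E t v)" using that(2) norm_triangle_ineq by metis
    also have "norm (E t v) \<le> q * norm v"
      using norm_blinfun[of "E t" v] q(2)[OF that(1)] mult_right_mono[of "norm (E t)" q "norm v"]
      by simp
    finally show ?thesis by (simp add: algebra_simps)
  qed
  have "\<exists>w. w = a t + E t w" if t: "t \<in> I" for t
  proof -
    have "\<exists>!w\<in>UNIV. a t + E t w = w"
    proof (rule Banach_fix)
      show "complete (UNIV::'b set)" by (rule complete_UNIV)
      show "0 \<le> q" using q(2)[OF t] norm_ge_zero order_trans by blast
      show "dist (a t + E t v) (a t + E t w) \<le> q * dist v w" for v w
        using norm_blinfun[of "E t" "v - w"] q(2)[OF t]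
          mult_right_mono[of "norm (E t)" q "norm (v - w)"]
        by (simp add: dist_norm blinfun.diff_right)
    qed (use q in auto)
    then show ?thesis by metis
  qed
  then obtain \<delta>' where \<delta>': "\<And>t. t \<in> I \<Longrightarrow> \<delta>' t = a t + E t (\<delta>' t)" by metis
  have "(\<delta> has_vector_derivative \<delta>' t) (at t)" if t: "t \<in> I" for t
    unfolding has_vector_derivative_def has_derivative_at_alt
  proof (intro conjI allI impI)
    show "bounded_linear (\<lambda>x. x *\<^sub>R \<delta>' t)" by (rule bounded_linear_scaleR_left)
    fix e :: real assume "e > 0"
    define K' where "K' = 1 + \<bar>K\<bar>"
    have K': "K' > 0" by (simp add: K'_def)
    define e' where "e' = e * (1 - q) / K'"
    have "e' > 0" using \<open>e > 0\<close> q(1) K' by (simp add: e'_def)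
    then obtain d where d: "d > 0" "\<And>p. norm (p - (t, \<delta> t)) < d \<Longrightarrow>
        norm (h p - h (t, \<delta> t) - (fst (p - (t, \<delta> t)) *\<^sub>R a t + E t (snd (p - (t, \<delta> t)))))
          \<le> e' * norm (p - (t, \<delta> t))"
      using deriv[OF t] unfolding has_derivative_at_alt by blast
    obtain d2 where d2: "d2 > 0" "ball t d2 \<subseteq> I" using I t open_contains_ball by blast
    show "\<exists>d>0. \<forall>s. norm (s - t) < d \<longrightarrow>
        norm (\<delta> s - \<delta> t - (s - t) *\<^sub>R \<delta>' t) \<le> e * norm (s - t)"
    proof (intro exI[of _ "min d2 (d / K')"] conjI allI impI)
      show "0 < min d2 (d / K')" using d d2 K' by simp
      fix s assume s: "norm (s - t) < min d2 (d / K')"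
      then have "s \<in> I" using d2(2) by (auto simp: dist_norm norm_minus_commute)
      have "norm (s - t, \<delta> s - \<delta> t) \<le> \<bar>s - t\<bar> + K * \<bar>s - t\<bar>"
        using norm_Pair_le[of "s - t" "\<delta> s - \<delta> t"] lip[OF \<open>s \<in> I\<close> t] by simp
      also have "\<dots> \<le> K' * \<bar>s - t\<bar>"
        by (simp add: K'_def algebra_simps mult_right_mono)
      finally have near: "norm (s - t, \<delta> s - \<delta> t) \<le> K' * \<bar>s - t\<bar>" .
      also have "\<dots> < d" using s K' by (simp add: field_simps)
      finally have "norm (s - t, \<delta> s - \<delta> t) < d" .
      then have "norm (\<delta> s - \<delta> t - ((s - t) *\<^sub>R a t + E t (\<delta> s - \<delta> t)))
          \<le> e' * norm (s - t, \<delta> s - \<delta> t)"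
        using d(2)[of "(s, \<delta> s)"] fixed[OF t] fixed[OF \<open>s \<in> I\<close>] by simp
      also have "\<dots> \<le> e' * (K' * \<bar>s - t\<bar>)" using near \<open>e' > 0\<close> by (intro mult_left_mono) auto
      also have "\<dots> = (1 - q) * (e * \<bar>s - t\<bar>)" using K' by (simp add: e'_def)
      finally have rem: "norm (\<delta> s - \<delta> t - ((s - t) *\<^sub>R a t + E t (\<delta> s - \<delta> t)))
          \<le> (1 - q) * (e * \<bar>s - t\<bar>)" .
      have "(s - t) *\<^sub>R \<delta>' t = (s - t) *\<^sub>R a t + (s - t) *\<^sub>R E t (\<delta>' t)"
        by (subst \<delta>'[OF t]) (simp add: scaleR_add_right)
      moreover have "E t (\<delta> s - \<delta> t - (s - t) *\<^sub>R \<delta>' t)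
          = E t (\<delta> s - \<delta> t) - (s - t) *\<^sub>R E t (\<delta>' t)"
        by (simp only: blinfun.diff_right blinfun.scaleR_right)
      ultimately have "\<delta> s - \<delta> t - (s - t) *\<^sub>R \<delta>' t
          = (\<delta> s - \<delta> t - ((s - t) *\<^sub>R a t + E t (\<delta> s - \<delta> t)))
            + E t (\<delta> s - \<delta> t - (s - t) *\<^sub>R \<delta>' t)"
        by simp
      then have "(1 - q) * norm (\<delta> s - \<delta> t - (s - t) *\<^sub>R \<delta>' t)
          \<le> norm (\<delta> s - \<delta> t - ((s - t) *\<^sub>R a t + E t (\<delta> s - \<delta> t)))"
        by (rule absorb[OF t])
      with rem have "(1 - q) * norm (\<delta> s - \<delta> t - (s - t) *\<^sub>R \<delta>' t) \<le> (1 - q) * (e * \<bar>s - t\<bar>)"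
        by linarith
      then show "norm (\<delta> s - \<delta> t - (s - t) *\<^sub>R \<delta>' t) \<le> e * norm (s - t)"
        using q(1) by simp
    qed
  qed
  moreover have "continuous_on I \<delta>'"
    unfolding continuous_on_def
  proof
    fix t assume t: "t \<in> I"
    have "((\<lambda>s. (1 / (1 - q)) * norm ((a s - a t) + (E s - E t) (\<delta>' t)))
        \<longlongrightarrow> (1 / (1 - q)) * norm ((a t - a t) + (E t - E t) (\<delta>' t))) (at t within I)"
      using cont t unfolding continuous_on_def by (intro tendsto_intros) auto
    then have lim: "((\<lambda>s. (1 / (1 - q)) * norm ((a s - a t) + (E s - E t) (\<delta>' t))) \<longlongrightarrow> 0)
        (at t within I)"
      by simp
    have "norm (\<delta>' s - \<delta>' t) \<le> (1 / (1 - q)) * norm ((a s - a t) + (E s - E t) (\<delta>' t))"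
      if "s \<in> I" for s
    proof -
      have "(1 - q) * norm (\<delta>' s - \<delta>' t) \<le> norm ((a s - a t) + (E s - E t) (\<delta>' t))"
      proof (rule absorb[OF that])
        have "\<delta>' s - \<delta>' t = (a s + E s (\<delta>' s)) - (a t + E t (\<delta>' t))"
          using \<delta>'[OF t] \<delta>'[OF that] by simp
        also have "\<dots> = (a s - a t) + (E s (\<delta>' s) - E t (\<delta>' t))" by (rule add_diff_add)
        finally have "\<delta>' s - \<delta>' t = (a s - a t) + (E s (\<delta>' s) - E t (\<delta>' t))" .
        moreover have "(E s - E t) (\<delta>' t) + E s (\<delta>' s - \<delta>' t) = E s (\<delta>' s) - E t (\<delta>' t)"
          by (simp add: blinfun.diff_right blinfun.diff_left)
        ultimately show "\<delta>' s - \<delta>' t = a s - a t + (E s - E t) (\<delta>' t) + E s (\<delta>' s - \<delta>' t)"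
          by (simp only: add.assoc)
      qed
      then show ?thesis using q(1) by (simp add: field_simps)
    qed
    then have bound: "eventually (\<lambda>s. norm (\<delta>' s - \<delta>' t)
        \<le> (1 / (1 - q)) * norm ((a s - a t) + (E s - E t) (\<delta>' t))) (at t within I)"
      by (simp add: eventually_at_filter)
    have "((\<lambda>s. \<delta>' s - \<delta>' t) \<longlongrightarrow> 0) (at t within I)"
      using bound lim by (rule Lim_null_comparison)
    then show "(\<delta>' \<longlongrightarrow> \<delta>' t) (at t within I)" by (rule LIM_zero_cancel)
  qed
  ultimately show ?thesis using that \<delta>' by blast
qed


section \<open>The constrained retraction at a point\<close>

text \<open>A derivative within a subspace controls \<open>f\<close> only in directions of that subspace, and its operator norm
on the whole space may be large.  Hence the mean value inequality is stated with a bound on the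
single vector \<open>f' y (u - w)\<close>, obtained by restricting \<open>f\<close> to the segment from \<open>w\<close> to \<open>u\<close>.\<close>

lemma mean_value_on_subspace:
  fixes f :: "'a::real_normed_vector \<Rightarrow> 'b::real_normed_vector"
  assumes T: "subspace T" "u \<in> T" "w \<in> T" "norm u \<le> b" "norm w \<le> b"
    and f: "\<And>y. y \<in> T \<Longrightarrow> (f has_derivative f' y) (at y within T)"
    and bound: "\<And>y. y \<in> T \<Longrightarrow> norm y \<le> b \<Longrightarrow> norm (f' y (u - w)) \<le> K"
  shows "norm (f u - f w) \<le> K"
proof -
  define l where "l t = w + t *\<^sub>R (u - w)" for t
  have l_T: "l t \<in> T" for t
    using T by (simp add: l_def subspace_add subspace_diff subspace_mul)
  have l_norm: "norm (l t) \<le> b" if "t \<in> {0..1}" for t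
  proof -
    have "(1 - t) *\<^sub>R w + t *\<^sub>R u \<in> cball 0 b"
      using that T by (intro convexD[OF convex_cball]) auto
    moreover have "(1 - t) *\<^sub>R w + t *\<^sub>R u = l t" by (simp add: l_def algebra_simps)
    ultimately show ?thesis by simp
  qed
  have der: "((\<lambda>t. f (l t)) has_derivative (\<lambda>s. s *\<^sub>R f' (l t) (u - w))) (at t within {0..1})" for t
  proof -
    have "(l has_derivative (\<lambda>s. s *\<^sub>R (u - w))) (at t within {0..1})"
      unfolding l_def by (auto intro!: derivative_eq_intros)
    then have "((\<lambda>t. f (l t)) has_derivative (\<lambda>s. f' (l t) (s *\<^sub>R (u - w)))) (at t within {0..1})"
      by (rule has_derivative_in_compose)
        (rule has_derivative_subset[OF f[OF l_T]], use l_T in auto)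
    moreover have "linear (f' (l t))" using f[OF l_T] by (rule has_derivative_linear)
    ultimately show ?thesis by (simp add: linear_scale)
  qed
  have "norm (f (l 1) - f (l 0)) \<le> K * norm (1 - 0 :: real)"
  proof (rule differentiable_bound[OF _ der])
    show "onorm (\<lambda>s. s *\<^sub>R f' (l t) (u - w)) \<le> K" if "t \<in> {0..1}" for t
    proof (rule onorm_bound)
      have *: "norm (f' (l t) (u - w)) \<le> K" using l_T l_norm[OF that] by (rule bound)
      then show "0 \<le> K" using norm_ge_zero order_trans by blast
      show "norm (s *\<^sub>R f' (l t) (u - w)) \<le> K * norm s" for s
        using mult_right_mono[OF *, of "\<bar>s\<bar>"] by (simp add: mult.commute)
    qed
  qed auto
  then show ?thesis by (simp add: l_def)
qed

text \<open>The conditions \<open>radii\<close> are what the contraction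
argument needs of \<open>r\<close> and \<open>\<Delta>\<close>: the arguments \<open>v - P B\<^sup>* \<delta>\<close> stay where the derivatives of the retraction are
bounded, the fixed point map has Lipschitz constant \<open>1/2\<close>, and it moves the centre of the ball of
radius \<open>r\<close> by at most \<open>r/2\<close>.\<close>

locale constrained_retraction_at =
  fixes M :: "'e::{real_inner,banach} set" and B :: "'e \<Rightarrow>\<^sub>L 'y::{real_inner,banach}" and c :: 'y
    and P :: "'e \<Rightarrow> 'e \<Rightarrow>\<^sub>L 'e" and R :: "'e \<Rightarrow> 'e \<Rightarrow> 'e" and DR :: "'e \<Rightarrow> 'e \<Rightarrow> 'e \<Rightarrow>\<^sub>L 'e"
    and D2R :: "'e \<Rightarrow> 'e \<Rightarrow> 'e \<Rightarrow>\<^sub>L 'e \<Rightarrow>\<^sub>L 'e"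
    and z :: 'e and C KP KL \<sigma> K1 K2 r \<Delta> :: real
  assumes Bz: "B z = c"
    and range_P: "range (P z) = tangent_space M z" and P_idem: "\<And>w. P z (P z w) = P z w"
    and R_into: "\<And>u. u \<in> tangent_space M z \<Longrightarrow> R z u \<in> M"
    and R_C2: "has_C2_derivs (tangent_space M z) (R z) (DR z) (D2R z)"
    and R_0: "R z 0 = z" and DR_0: "\<And>w. w \<in> tangent_space M z \<Longrightarrow> DR z 0 w = w"
    and coercive: "C > 0" "\<And>\<delta>. L_op B P z \<delta> \<bullet> \<delta> \<ge> C * (norm \<delta>)\<^sup>2"
    and KP: "norm (P z) \<le> KP" and KL: "onorm (inv (L_op B P z)) \<le> KL"
    and R_bounds: "retraction_bounds M DR D2R {z} \<sigma> K1 K2"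
    and radii: "0 < \<Delta>" "0 \<le> r" "\<Delta> + KP * norm B * r \<le> \<sigma>"
      "KL * norm B * (K2 * (\<Delta> + KP * norm B * r)) * (KP * norm B) \<le> 1/2"
      "KL * norm B * (K1 * \<Delta>) \<le> r / 2"
begin

abbreviation T where "T \<equiv> tangent_space M z"

text \<open>A bound for \<open>\<parallel>v - P B\<^sup>* \<delta>\<parallel>\<close> when \<open>\<parallel>v\<parallel> \<le> \<Delta>\<close> and \<open>\<parallel>\<delta>\<parallel> \<le> r\<close>.\<close>

definition reach where "reach = \<Delta> + KP * norm B * r"

definition Q :: "'y \<Rightarrow>\<^sub>L 'e" where "Q = P z o\<^sub>L Blinfun (adjoint B)"

definition Linv :: "'y \<Rightarrow>\<^sub>L 'y" where "Linv = Blinfun (inv (L_op B P z))"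

text \<open>The deviation of the retraction from the affine map \<open>u \<mapsto> z + u\<close>.  Isolating it makes the constraint a
fixed point equation with a small right-hand side.\<close>

definition N where "N u = R z u - z - u"

lemma Q_apply: "Q \<delta> = P z (adjoint B \<delta>)"
  by (simp add: Q_def bounded_linear_Blinfun_apply bounded_linear_adjoint_Hilbert)

lemma P_in_T: "P z w \<in> T"
  using range_P by blast

lemma P_fixes_T: "w \<in> T \<Longrightarrow> P z w = w"
  using P_idem range_P by (metis imageE)

lemma Q_in_T: "Q \<delta> \<in> T"
  by (simp add: Q_apply P_in_T)

lemma subspace_T: "subspace T"
  using linear_subspace_image[OF bounded_linear.linear[OF blinfun.bounded_linear_right]
      subspace_UNIV, of "P z"] range_P by simp

lemma closed_T: "closed T"
proof -
  have "T = {w. P z w = w}" using P_fixes_T P_in_T by (metis (mono_tags) Collect_eqI Collect_mem_eq)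
  moreover have "closed {w. P z w = w}" by (intro closed_Collect_eq continuous_intros)
  ultimately show ?thesis by simp
qed

lemma KP_nonneg: "0 \<le> KP"
  using KP norm_ge_zero order_trans by blast

lemma norm_Q_le: "norm (Q \<delta>) \<le> KP * norm B * norm \<delta>"
proof -
  have "norm (Q \<delta>) \<le> norm (P z) * norm (adjoint B \<delta>)" unfolding Q_apply by (rule norm_blinfun)
  also have "\<dots> \<le> KP * (norm B * norm \<delta>)"
    using KP KP_nonneg by (intro mult_mono norm_adjoint_Hilbert_le) auto
  finally show ?thesis by (simp add: mult.assoc)
qed

lemma L_op_eq: "L_op B P z = (\<lambda>\<delta>. B (Q \<delta>))"
  by (rule ext) (simp add: L_op_def Q_apply)

lemma bounded_linear_L: "bounded_linear (L_op B P z)"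
  unfolding L_op_eq by (intro blinfun.bounded_linear_right bounded_linear_compose[of B])

lemmas L_invertible = coercive_operator_invertible[OF bounded_linear_L coercive]

lemma Linv_apply: "Linv y = inv (L_op B P z) y"
  by (simp add: Linv_def bounded_linear_Blinfun_apply L_invertible(2))

lemma Linv_eq_iff: "Linv y = \<delta> \<longleftrightarrow> B (Q \<delta>) = y"
  using bij_inv_eq_iff[OF L_invertible(1), of \<delta> y] unfolding Linv_apply L_op_eq by metis

lemma norm_Linv_le: "norm (Linv y) \<le> KL * norm y"
proof -
  have "norm (Linv y) \<le> onorm (inv (L_op B P z)) * norm y"
    unfolding Linv_apply using L_invertible(2) by (rule onorm)
  then show ?thesis using KL mult_right_mono[OF KL, of "norm y"] by simp
qed

lemma KL_nonneg: "0 \<le> KL"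
  using KL onorm_pos_le[OF L_invertible(2)] by linarith

lemma K_pos: "0 < K1" "0 < K2"
  and DR_bound: "u \<in> T \<Longrightarrow> norm u \<le> reach \<Longrightarrow> w \<in> T \<Longrightarrow> norm (DR z u w) \<le> K1 * norm w"
  and D2R_bound: "u \<in> T \<Longrightarrow> norm u \<le> reach \<Longrightarrow> w \<in> T \<Longrightarrow> w' \<in> T \<Longrightarrow>
    norm (D2R z u w w') \<le> K2 * norm w * norm w'"
  using R_bounds radii(3) unfolding retraction_bounds_def reach_def by auto

lemma DR_deriv: "u \<in> T \<Longrightarrow> (R z has_derivative DR z u) (at u within T)"
  and D2R_deriv: "u \<in> T \<Longrightarrow> (DR z has_derivative D2R z u) (at u within T)"
  using R_C2 by (auto simp: has_C2_derivs_def)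

lemma zero_T: "0 \<in> T"
  using subspace_T by (rule subspace_0)

lemma reach_nonneg: "0 \<le> reach"
  using radii(1,2) KP_nonneg by (simp add: reach_def)

lemma DR_near_identity:
  assumes "u \<in> T" "norm u \<le> reach" "w \<in> T"
  shows "norm (DR z u w - w) \<le> K2 * reach * norm w"
proof -
  have "norm (DR z u w - DR z 0 w) \<le> K2 * norm u * norm w"
  proof (rule mean_value_on_subspace[where f = "\<lambda>u. DR z u w" and b = reach])
    show "((\<lambda>u. DR z u w) has_derivative (\<lambda>h. D2R z y h w)) (at y within T)" if "y \<in> T" for y
      using D2R_deriv[OF that]
      by (rule bounded_linear.has_derivative[OF blinfun.bounded_linear_left])
    show "norm (D2R z y (u - 0) w) \<le> K2 * norm u * norm w" if "y \<in> T" "norm y \<le> reach" for y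
      using D2R_bound[OF that assms(1,3)] by simp
  qed (use assms subspace_T zero_T reach_nonneg in auto)
  also have "\<dots> \<le> K2 * reach * norm w"
    using assms K_pos by (intro mult_right_mono mult_left_mono) auto
  finally show ?thesis using DR_0[OF assms(3)] by simp
qed

lemma N_Lipschitz:
  assumes "u \<in> T" "norm u \<le> reach" "w \<in> T" "norm w \<le> reach"
  shows "norm (N u - N w) \<le> K2 * reach * norm (u - w)"
proof (rule mean_value_on_subspace[where f = N and b = reach])
  show "(N has_derivative (\<lambda>h. DR z y h - h)) (at y within T)" if "y \<in> T" for y
    unfolding N_def by (auto intro!: derivative_eq_intros DR_deriv that)
  show "norm (DR z y (u - w) - (u - w)) \<le> K2 * reach * norm (u - w)"
    if "y \<in> T" "norm y \<le> reach" for y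
    using that assms subspace_T by (intro DR_near_identity) (auto simp: subspace_diff)
qed (use assms subspace_T in auto)

lemma norm_R_diff_le:
  assumes "u \<in> T" "norm u \<le> reach"
  shows "norm (R z u - z) \<le> K1 * norm u"
proof -
  have "norm (R z u - R z 0) \<le> K1 * norm u"
  proof (rule mean_value_on_subspace[where f = "R z" and b = reach])
    show "norm (DR z y (u - 0)) \<le> K1 * norm u" if "y \<in> T" "norm y \<le> reach" for y
      using DR_bound[OF that assms(1)] by simp
  qed (use assms subspace_T zero_T reach_nonneg DR_deriv in auto)
  then show ?thesis by (simp add: R_0)
qed

definition corr where "corr v = correction B c P R r z v"

lemma norm_Linv_B_le: "norm (Linv (B w)) \<le> KL * norm B * norm w"
proof -
  have "norm (Linv (B w)) \<le> KL * norm (B w)" by (rule norm_Linv_le)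
  also have "\<dots> \<le> KL * (norm B * norm w)" using KL_nonneg by (intro mult_left_mono norm_blinfun)
  finally show ?thesis by (simp add: mult.assoc)
qed

text \<open>Since \<open>B z = c\<close> and \<open>B v = 0\<close>, expanding \<open>R(u) = z + u + N(u)\<close> at \<open>u = v - Q \<delta>\<close> leaves
\<open>- L \<delta> + B N(u) = 0\<close>.\<close>

lemma constraint_iff_fixed_point:
  assumes "B v = 0"
  shows "B (R z (v - Q \<delta>)) = c \<longleftrightarrow> Linv (B (N (v - Q \<delta>))) = \<delta>"
  using assms Bz by (auto simp: Linv_eq_iff N_def blinfun.diff_right)

lemma shifted_in_T: "v \<in> T \<Longrightarrow> v - Q \<delta> \<in> T"
  by (simp add: subspace_T subspace_diff Q_in_T)

lemma norm_shifted_le: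
  assumes "norm v \<le> \<Delta>" "norm \<delta> \<le> r"
  shows "norm (v - Q \<delta>) \<le> reach"
proof -
  have "norm (v - Q \<delta>) \<le> norm v + norm (Q \<delta>)" by (rule norm_triangle_ineq4)
  also have "norm (Q \<delta>) \<le> KP * norm B * r"
    using norm_Q_le[of \<delta>] assms(2) KP_nonneg mult_left_mono[of "norm \<delta>" r "KP * norm B"] by simp
  finally show ?thesis using assms(1) by (simp add: reach_def)
qed

text \<open>With \<open>v = w\<close> this is the contraction property; with \<open>v\<close> and \<open>w\<close> on a common ray it makes the fixed
point a Lipschitz function of the ray parameter.\<close>

lemma fixed_point_map_Lipschitz:
  assumes "v \<in> T" "norm v \<le> \<Delta>" "w \<in> T" "norm w \<le> \<Delta>" "norm \<delta> \<le> r" "norm \<eta> \<le> r"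
  shows "norm (Linv (B (N (v - Q \<delta>))) - Linv (B (N (w - Q \<eta>))))
    \<le> KL * norm B * (K2 * reach) * norm (v - w) + norm (\<delta> - \<eta>) / 2"
proof -
  let ?k = "KL * norm B * (K2 * reach)"
  have k: "0 \<le> ?k" using KL_nonneg K_pos reach_nonneg by simp
  have "norm (Linv (B (N (v - Q \<delta>))) - Linv (B (N (w - Q \<eta>))))
      = norm (Linv (B (N (v - Q \<delta>) - N (w - Q \<eta>))))"
    by (simp add: blinfun.diff_right)
  also have "\<dots> \<le> KL * norm B * norm (N (v - Q \<delta>) - N (w - Q \<eta>))" by (rule norm_Linv_B_le)
  also have "\<dots> \<le> KL * norm B * (K2 * reach * norm ((v - Q \<delta>) - (w - Q \<eta>)))"
    using KL_nonneg assms by (intro mult_left_mono N_Lipschitz shifted_in_T norm_shifted_le) auto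
  also have "\<dots> = ?k * norm ((v - w) - Q (\<delta> - \<eta>))"
    by (simp add: blinfun.diff_right algebra_simps)
  also have "\<dots> \<le> ?k * (norm (v - w) + KP * norm B * norm (\<delta> - \<eta>))"
    using k norm_Q_le[of "\<delta> - \<eta>"] norm_triangle_ineq4[of "v - w" "Q (\<delta> - \<eta>)"]
    by (intro mult_left_mono) auto
  also have "\<dots> = ?k * norm (v - w) + (?k * (KP * norm B)) * norm (\<delta> - \<eta>)"
    by (simp add: algebra_simps)
  also have "\<dots> \<le> ?k * norm (v - w) + (1/2) * norm (\<delta> - \<eta>)"
    using radii(4) by (intro add_left_mono mult_right_mono) (auto simp: reach_def)
  finally show ?thesis by simp
qed

lemma correction_exists_unique:
  assumes v: "v \<in> T" "B v = 0" "norm v \<le> \<Delta>"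
  shows "\<exists>!\<delta>. norm \<delta> \<le> r \<and> B (R z (v - P z (adjoint B \<delta>))) = c"
proof -
  let ?\<Phi> = "\<lambda>\<delta>. Linv (B (N (v - Q \<delta>)))"
  have v_reach: "norm v \<le> reach"
    using norm_shifted_le[of v 0] v radii(2) by (simp add: blinfun.zero_right)
  have "\<exists>!\<delta>\<in>cball 0 r. ?\<Phi> \<delta> = \<delta>"
  proof (rule Banach_fix)
    show "complete (cball (0::'y) r)" by (simp add: complete_eq_closed)
    show "cball (0::'y) r \<noteq> {}" using radii(2) by simp
    have lip: "dist (?\<Phi> \<delta>) (?\<Phi> \<eta>) \<le> (1/2) * dist \<delta> \<eta>" if "norm \<delta> \<le> r" "norm \<eta> \<le> r" for \<delta> \<eta>
      using fixed_point_map_Lipschitz[OF v(1,3) v(1,3) that] by (simp add: dist_norm)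
    then show "dist (?\<Phi> \<delta>) (?\<Phi> \<eta>) \<le> (1/2) * dist \<delta> \<eta>"
      if "\<delta> \<in> cball 0 r" "\<eta> \<in> cball 0 r" for \<delta> \<eta>
      using that by simp
    show "?\<Phi> ` cball 0 r \<subseteq> cball 0 r"
    proof safe
      fix \<delta> :: 'y assume "\<delta> \<in> cball 0 r"
      then have \<delta>: "norm \<delta> \<le> r" by simp
      \<comment> \<open>The centre of the ball is estimated through \<open>K1\<close>, since \<open>B v = 0\<close> gives \<open>B N(v) = B (R(v) - z)\<close>.\<close>
      have "B (N v) = B (R z v - z)" using v(2) by (simp add: N_def blinfun.diff_right)
      then have "norm (?\<Phi> 0) \<le> KL * norm B * norm (R z v - z)"
        using norm_Linv_B_le[of "R z v - z"] by (simp add: blinfun.zero_right)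
      also have "\<dots> \<le> KL * norm B * (K1 * \<Delta>)"
      proof (rule mult_left_mono)
        show "norm (R z v - z) \<le> K1 * \<Delta>"
          using norm_R_diff_le[OF v(1) v_reach] mult_left_mono[OF v(3), of K1] K_pos(1) by linarith
      qed (use KL_nonneg in simp)
      also have "\<dots> \<le> r / 2" by (rule radii(5))
      finally have "norm (?\<Phi> 0) \<le> r / 2" .
      moreover have "dist (?\<Phi> \<delta>) (?\<Phi> 0) \<le> (1/2) * r"
        using lip[OF \<delta>, of 0] \<delta> radii(2) by simp
      ultimately show "?\<Phi> \<delta> \<in> cball 0 r"
        using norm_triangle_ineq2[of "?\<Phi> \<delta>" "?\<Phi> 0"] by (simp add: dist_norm)
    qed
  qed auto
  then show ?thesis
    using constraint_iff_fixed_point[OF v(2)] by (simp add: Q_apply)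
qed

lemma corr:
  assumes "v \<in> T" "B v = 0" "norm v \<le> \<Delta>"
  shows norm_corr_le: "norm (corr v) \<le> r"
    and corr_solves: "B (R z (v - Q (corr v))) = c"
    and corr_fixed_point: "Linv (B (N (v - Q (corr v)))) = corr v"
proof -
  from theI'[OF correction_exists_unique[OF assms]]
  show "norm (corr v) \<le> r" and *: "B (R z (v - Q (corr v))) = c"
    by (simp_all add: corr_def correction_def Q_apply)
  show "Linv (B (N (v - Q (corr v)))) = corr v"
    using * constraint_iff_fixed_point[OF assms(2)] by simp
qed

lemma corr_unique:
  assumes "v \<in> T" "B v = 0" "norm v \<le> \<Delta>" "norm \<delta> \<le> r" "B (R z (v - Q \<delta>)) = c"
  shows "corr v = \<delta>"
  using correction_exists_unique[OF assms(1-3)] assms(4,5)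
    norm_corr_le[OF assms(1-3)] corr_solves[OF assms(1-3)]
  unfolding Q_apply by blast

lemma corr_0: "corr 0 = 0"
  using radii(1,2) zero_T by (intro corr_unique) (simp_all add: blinfun.zero_right R_0 Bz)

definition RB where "RB v = constrained_retraction B c P R r z v"

lemma RB_eq: "RB v = R z (v - Q (corr v))"
  by (simp add: RB_def constrained_retraction_def corr_def Q_apply)

lemma RB_in_constraint_set:
  assumes "v \<in> T" "B v = 0" "norm v \<le> \<Delta>"
  shows "RB v \<in> {y \<in> M. B y = c}"
  using corr_solves[OF assms] R_into[OF shifted_in_T[OF assms(1)]] by (simp add: RB_eq)

lemma RB_0: "RB 0 = z"
  by (simp add: RB_eq corr_0 blinfun.zero_right R_0)

text \<open>The correction along the ray solves \<open>\<delta>(t) = L\<^sup>-\<^sup>1 B N(t v - Q \<delta>(t))\<close>, so it is \<open>C\<^sup>1\<close> as a fixed point of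
\<open>C\<^sup>1\<close> contractions.  At \<open>t = 0\<close> the correction vanishes and \<open>D N(0) = 0\<close> on tangent vectors, hence
\<open>\<delta>'(0) = 0\<close> and the corrected curve keeps the velocity \<open>v\<close>.\<close>

lemma RB_ray_C1:
  assumes v: "v \<in> T" "B v = 0"
  defines "I \<equiv> {t. norm (t *\<^sub>R v) < \<Delta>}"
  obtains \<gamma>' where "\<And>t. t \<in> I \<Longrightarrow> ((\<lambda>t. RB (t *\<^sub>R v)) has_vector_derivative \<gamma>' t) (at t)"
    "continuous_on I \<gamma>'" "\<gamma>' 0 = v"
proof -
  define \<delta> where "\<delta> t = corr (t *\<^sub>R v)" for t
  define u where "u t = t *\<^sub>R v - Q (\<delta> t)" for t
  define h where "h p = Linv (B (N (fst p *\<^sub>R v - Q (snd p))))" for p :: "real \<times> 'y"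
  define a where "a t = Linv (B (DR z (u t) v - v))" for t
  define E where "E t = - (Linv o\<^sub>L (B o\<^sub>L ((DR z (u t) - id_blinfun) o\<^sub>L Q)))" for t
  have ray: "t *\<^sub>R v \<in> T" "B (t *\<^sub>R v) = 0" for t
    using v by (auto simp: subspace_mul subspace_T blinfun.scaleR_right)
  have in_I: "norm (t *\<^sub>R v) \<le> \<Delta>" if "t \<in> I" for t using that by (simp add: I_def)
  have u_T: "u t \<in> T" for t unfolding u_def by (rule shifted_in_T[OF ray(1)])
  have u_norm: "norm (u t) \<le> reach" if "t \<in> I" for t
    unfolding u_def \<delta>_def using norm_shifted_le in_I norm_corr_le ray that by blast
  have open_I: "open I" unfolding I_def by (intro open_Collect_less continuous_intros)
  have "0 \<in> I" using radii(1) by (simp add: I_def)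
  have fixed: "h (t, \<delta> t) = \<delta> t" if "t \<in> I" for t
    unfolding h_def \<delta>_def using corr_fixed_point[OF ray in_I[OF that]] by simp
  have lip: "norm (\<delta> s - \<delta> t) \<le> (2 * (KL * norm B * (K2 * reach)) * norm v) * \<bar>s - t\<bar>"
    if "s \<in> I" "t \<in> I" for s t
  proof -
    have "norm (h (s, \<delta> s) - h (t, \<delta> t))
        \<le> KL * norm B * (K2 * reach) * norm (s *\<^sub>R v - t *\<^sub>R v) + norm (\<delta> s - \<delta> t) / 2"
      unfolding h_def fst_conv snd_conv \<delta>_def
      by (intro fixed_point_map_Lipschitz ray in_I that norm_corr_le)
    moreover have "norm (s *\<^sub>R v - t *\<^sub>R v) = \<bar>s - t\<bar> * norm v"
      by (simp flip: scaleR_diff_left)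
    ultimately show ?thesis using fixed[OF that(1)] fixed[OF that(2)] by (simp add: algebra_simps)
  qed
  have deriv: "(h has_derivative (\<lambda>p. fst p *\<^sub>R a t + E t (snd p))) (at (t, \<delta> t))" for t
  proof -
    define w where "w p = fst p *\<^sub>R v - Q (snd p)" for p :: "real \<times> 'y"
    \<comment> \<open>The retraction is differentiable only within the tangent space; the values of \<open>w\<close> lie there.\<close>
    have w_T: "w p \<in> T" for p unfolding w_def by (rule shifted_in_T[OF ray(1)])
    have "(w has_derivative w) (at (t, \<delta> t))"
      unfolding w_def by (auto intro!: derivative_eq_intros)
    moreover have "(N has_derivative (\<lambda>k. DR z (u t) k - k)) (at (u t) within T)"
      unfolding N_def by (auto intro!: derivative_eq_intros DR_deriv u_T)
    then have "(N has_derivative (\<lambda>k. DR z (u t) k - k)) (at (u t) within range w)"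
      by (rule has_derivative_subset) (use w_T in blast)
    then have "(N has_derivative (\<lambda>k. DR z (u t) k - k)) (at (w (t, \<delta> t)) within range w)"
      by (simp add: w_def u_def)
    ultimately have "((\<lambda>p. N (w p)) has_derivative (\<lambda>p. DR z (u t) (w p) - w p)) (at (t, \<delta> t))"
      by (rule has_derivative_in_compose)
    then have "((\<lambda>p. Linv (B (N (w p)))) has_derivative
        (\<lambda>p. Linv (B (DR z (u t) (w p) - w p)))) (at (t, \<delta> t))"
      by (intro bounded_linear.has_derivative[OF blinfun.bounded_linear_right])
    moreover have "Linv (B (DR z (u t) (w p) - w p)) = fst p *\<^sub>R a t + E t (snd p)" for p
      by (simp add: w_def a_def E_def blinfun.bilinear_simps algebra_simps)
    ultimately show ?thesis by (simp add: h_def[abs_def] w_def)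
  qed
  have E_norm: "norm (E t) \<le> 1/2" if "t \<in> I" for t
  proof (rule norm_blinfun_bound)
    fix y
    have "norm (E t y) = norm (Linv (B (DR z (u t) (Q y) - Q y)))"
      by (simp add: E_def blinfun.bilinear_simps norm_minus_commute)
    also have "\<dots> \<le> KL * norm B * norm (DR z (u t) (Q y) - Q y)" by (rule norm_Linv_B_le)
    also have "\<dots> \<le> KL * norm B * (K2 * reach * norm (Q y))"
      using KL_nonneg by (intro mult_left_mono DR_near_identity u_T u_norm that Q_in_T) auto
    also have "\<dots> \<le> KL * norm B * (K2 * reach * (KP * norm B * norm y))"
      using KL_nonneg K_pos reach_nonneg by (intro mult_left_mono norm_Q_le) auto
    also have "\<dots> = (KL * norm B * (K2 * reach) * (KP * norm B)) * norm y" by (simp add: algebra_simps)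
    also have "\<dots> \<le> 1/2 * norm y" using radii(4) by (intro mult_right_mono) (auto simp: reach_def)
    finally show "norm (E t y) \<le> 1/2 * norm y" .
  qed simp
  have \<delta>_cont: "continuous_on I \<delta>"
  proof (rule lipschitz_on_continuous_on, rule lipschitz_onI)
    show "dist (\<delta> s) (\<delta> t) \<le> (2 * (KL * norm B * (K2 * reach)) * norm v) * dist s t"
      if "s \<in> I" "t \<in> I" for s t
      using lip[OF that] by (simp add: dist_norm)
    show "0 \<le> 2 * (KL * norm B * (K2 * reach)) * norm v" using KL_nonneg K_pos reach_nonneg by simp
  qed
  have "continuous_on T (DR z)"
    using D2R_deriv by (intro has_derivative_continuous_on)
  moreover have "continuous_on I u" unfolding u_def by (intro continuous_intros \<delta>_cont)
  ultimately have DR_cont: "continuous_on I (\<lambda>t. DR z (u t))"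
    by (rule continuous_on_compose2) (use u_T in auto)
  have a_cont: "continuous_on I a" unfolding a_def by (intro continuous_intros DR_cont)
  have E_cont: "continuous_on I E" unfolding E_def by (intro continuous_intros DR_cont)
  have half: "1/2 < (1::real)" by simp
  obtain \<delta>' where \<delta>': "\<And>t. t \<in> I \<Longrightarrow> (\<delta> has_vector_derivative \<delta>' t) (at t)"
    "continuous_on I \<delta>'" "\<And>t. t \<in> I \<Longrightarrow> \<delta>' t = a t + E t (\<delta>' t)"
    using fixed_point_of_C1_contractions_is_C1[OF open_I fixed deriv half E_norm lip a_cont E_cont]
    by blast
  define \<gamma>' where "\<gamma>' t = DR z (u t) (v - Q (\<delta>' t))" for t
  show ?thesis
  proof (rule that)
    show "((\<lambda>t. RB (t *\<^sub>R v)) has_vector_derivative \<gamma>' t) (at t)" if "t \<in> I" for t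
    proof -
      have "(u has_derivative (\<lambda>s. s *\<^sub>R (v - Q (\<delta>' t)))) (at t)"
        unfolding u_def using \<delta>'(1)[OF that, unfolded has_vector_derivative_def]
        by (auto intro!: derivative_eq_intros bounded_linear.has_derivative[OF blinfun.bounded_linear_right]
            simp: blinfun.scaleR_right algebra_simps)
      moreover have "(R z has_derivative DR z (u t)) (at (u t) within range u)"
        using DR_deriv[OF u_T] by (rule has_derivative_subset) (use u_T in auto)
      ultimately have "((\<lambda>t. R z (u t)) has_derivative (\<lambda>s. DR z (u t) (s *\<^sub>R (v - Q (\<delta>' t))))) (at t)"
        by (rule has_derivative_in_compose)
      then show ?thesis
        by (simp add: has_vector_derivative_def RB_eq u_def \<delta>_def \<gamma>'_def blinfun.scaleR_right)
    qed
    show "continuous_on I \<gamma>'" unfolding \<gamma>'_def by (intro continuous_intros DR_cont \<delta>'(2))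
    have "u 0 = 0" by (simp add: u_def \<delta>_def corr_0 blinfun.zero_right)
    then have "a 0 = 0" "E 0 (\<delta>' 0) = 0"
      using DR_0 v Q_in_T by (simp_all add: a_def E_def blinfun.bilinear_simps)
    then have "\<delta>' 0 = 0" using \<delta>'(3)[OF \<open>0 \<in> I\<close>] by simp
    then show "\<gamma>' 0 = v" using DR_0 v \<open>u 0 = 0\<close> by (simp add: \<gamma>'_def blinfun.zero_right)
  qed
qed


section \<open>Tangent space and gradient of the constraint set\<close>

abbreviation MB where "MB \<equiv> {y \<in> M. B y = c}"

text \<open>A curve in the constraint set is a curve in \<open>M\<close> along which \<open>B\<close> is constant, which gives one inclusion;
the curves \<open>t \<mapsto> R\<^sup>B(t v)\<close> give the other.\<close>

lemma tangent_space_constraint_set: "tangent_space MB z = {v \<in> T. B v = 0}"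
proof (intro equalityI subsetI)
  fix v assume "v \<in> tangent_space MB z"
  then obtain \<gamma> \<epsilon> \<gamma>' where \<epsilon>: "\<epsilon> > 0" and \<gamma>: "\<gamma> ` {-\<epsilon><..<\<epsilon>} \<subseteq> MB"
    "\<forall>t\<in>{-\<epsilon><..<\<epsilon>}. (\<gamma> has_vector_derivative \<gamma>' t) (at t)"
    "continuous_on {-\<epsilon><..<\<epsilon>} \<gamma>'" "\<gamma> 0 = z" "\<gamma>' 0 = v"
    unfolding tangent_space_def curve_through_def by blast
  have "curve_through M z \<gamma> v"
    unfolding curve_through_def using \<epsilon> \<gamma> by (intro exI[of _ \<epsilon>] conjI exI[of _ \<gamma>']) auto
  then have "v \<in> T" by (auto simp: tangent_space_def)
  have "(\<gamma> has_vector_derivative v) (at 0)" using \<gamma>(2,5) \<epsilon> by auto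
  then have "((\<lambda>t. B (\<gamma> t)) has_vector_derivative B v) (at 0)"
    by (rule bounded_linear.has_vector_derivative[OF blinfun.bounded_linear_right])
  moreover have B\<gamma>: "B (\<gamma> t) = c" if "t \<in> {-\<epsilon><..<\<epsilon>}" for t using \<gamma>(1) that by blast
  have "((\<lambda>t. B (\<gamma> t)) has_vector_derivative 0) (at 0)"
    by (rule has_vector_derivative_transform_within_open[where f = "\<lambda>_. c" and S = "{-\<epsilon><..<\<epsilon>}"])
      (use \<epsilon> B\<gamma> in auto)
  ultimately have "B v = 0" by (rule vector_derivative_unique_at)
  with \<open>v \<in> T\<close> show "v \<in> {v \<in> T. B v = 0}" by simp
next
  fix v assume "v \<in> {v \<in> T. B v = 0}"
  then have v: "v \<in> T" "B v = 0" by auto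
  obtain \<gamma>' where \<gamma>': "\<And>t. norm (t *\<^sub>R v) < \<Delta> \<Longrightarrow>
      ((\<lambda>t. RB (t *\<^sub>R v)) has_vector_derivative \<gamma>' t) (at t)"
    "continuous_on {t. norm (t *\<^sub>R v) < \<Delta>} \<gamma>'" "\<gamma>' 0 = v"
    using RB_ray_C1[OF v] by (metis (lifting) mem_Collect_eq)
  define \<epsilon> where "\<epsilon> = \<Delta> / (norm v + 1)"
  have "\<epsilon> > 0" using radii(1) by (simp add: \<epsilon>_def add_nonneg_pos)
  have small: "norm (t *\<^sub>R v) < \<Delta>" if "t \<in> {-\<epsilon><..<\<epsilon>}" for t
  proof -
    have "\<bar>t\<bar> < \<epsilon>" using that by auto
    moreover have "0 < norm v + 1" by (simp add: add_nonneg_pos)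
    ultimately have "\<bar>t\<bar> * (norm v + 1) < \<Delta>" by (simp only: \<epsilon>_def pos_less_divide_eq)
    moreover have "norm (t *\<^sub>R v) \<le> \<bar>t\<bar> * (norm v + 1)" by (simp add: mult_left_mono)
    ultimately show ?thesis by linarith
  qed
  have "curve_through MB z (\<lambda>t. RB (t *\<^sub>R v)) v"
    unfolding curve_through_def
  proof (intro exI[of _ \<epsilon>] exI[of _ \<gamma>'] conjI ballI)
    have "RB (t *\<^sub>R v) \<in> MB" if "t \<in> {-\<epsilon><..<\<epsilon>}" for t
      using v less_imp_le[OF small[OF that]]
      by (intro RB_in_constraint_set) (auto simp: subspace_mul subspace_T blinfun.scaleR_right)
    then show "(\<lambda>t. RB (t *\<^sub>R v)) ` {-\<epsilon><..<\<epsilon>} \<subseteq> MB" by blast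
    show "continuous_on {-\<epsilon><..<\<epsilon>} \<gamma>'"
      using \<gamma>'(2) by (rule continuous_on_subset) (use small in blast)
  qed (use \<gamma>' small \<open>\<epsilon> > 0\<close> RB_0 in auto)
  then show "v \<in> tangent_space MB z" by (auto simp: tangent_space_def)
qed

text \<open>Existence is the Riesz theorem on the closed subspace of tangent vectors; uniqueness holds because
every tangent vector is the velocity of some curve, so two gradients have the same inner product with
their difference.\<close>

lemma riemannian_gradient:
  assumes J: "(J has_derivative J') (at z)"
  shows riemannian_gradient_tangent: "riemannian_gradient MB J z \<in> tangent_space MB z"
    and riemannian_gradient_inner:
      "\<And>v. v \<in> tangent_space MB z \<Longrightarrow> riemannian_gradient MB J z \<bullet> v = J' v"
proof -
  let ?TB = "tangent_space MB z"
  have TB: "?TB = T \<inter> {v. B v = 0}" by (auto simp: tangent_space_constraint_set)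
  have sub: "subspace ?TB"
    unfolding TB by (intro subspace_inter subspace_T)
      (auto simp: subspace_def blinfun.bilinear_simps)
  have "closed ?TB"
    unfolding TB by (intro closed_Int closed_T closed_Collect_eq continuous_intros)
  then obtain g where g: "g \<in> ?TB" "\<And>v. v \<in> ?TB \<Longrightarrow> g \<bullet> v = J' v"
    using riesz_representation_on_closed_subspace[OF sub _ has_derivative_bounded_linear[OF J]]
    by metis
  have chain: "((\<lambda>t. J (\<gamma> t)) has_real_derivative J' v) (at 0)" if "curve_through MB z \<gamma> v" for \<gamma> v
  proof -
    have "\<gamma> 0 = z" "(\<gamma> has_vector_derivative v) (at 0)"
      using that unfolding curve_through_def by auto
    then have "((J \<circ> \<gamma>) has_vector_derivative J' v) (at 0)"
      using vector_derivative_diff_chain_within[of \<gamma> v 0 UNIV J J']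
        has_derivative_at_withinI[OF J] by simp
    then show ?thesis
      by (simp add: has_real_derivative_iff_has_vector_derivative o_def)
  qed
  have grad: "riemannian_gradient MB J z = g"
    unfolding riemannian_gradient_def
  proof (rule the_equality)
    show "g \<in> ?TB \<and> (\<forall>\<gamma> v. curve_through MB z \<gamma> v \<longrightarrow>
        ((\<lambda>t. J (\<gamma> t)) has_real_derivative g \<bullet> v) (at 0))"
    proof (intro conjI allI impI g(1))
      fix \<gamma> v assume *: "curve_through MB z \<gamma> v"
      then have "v \<in> ?TB" by (auto simp: tangent_space_def)
      then show "((\<lambda>t. J (\<gamma> t)) has_real_derivative g \<bullet> v) (at 0)" using chain[OF *] g(2) by simp
    qed
    fix g' assume g': "g' \<in> ?TB \<and> (\<forall>\<gamma> v. curve_through MB z \<gamma> v \<longrightarrow>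
        ((\<lambda>t. J (\<gamma> t)) has_real_derivative g' \<bullet> v) (at 0))"
    have "g' \<bullet> v = g \<bullet> v" if v: "v \<in> ?TB" for v
    proof -
      obtain \<gamma> where "curve_through MB z \<gamma> v" using v by (auto simp: tangent_space_def)
      then show ?thesis using chain g' g(2)[OF v] DERIV_unique by metis
    qed
    moreover have "g' - g \<in> ?TB" using g' g(1) sub by (simp add: subspace_diff)
    ultimately have "(g' - g) \<bullet> (g' - g) = 0" by (metis inner_diff_left right_minus_eq)
    then show "g' = g" by simp
  qed
  show "riemannian_gradient MB J z \<in> ?TB" using g(1) grad by simp
  show "riemannian_gradient MB J z \<bullet> v = J' v" if "v \<in> ?TB" for v using g(2) that grad by simp
qed

text \<open>The chain rule along the corrected ray.  Since that ray leaves \<open>z\<close> with velocity \<open>\<xi>\<close> itself, the slope of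
the pullback at \<open>0\<close> is the slope that enters the Armijo condition.\<close>

lemma pullback_along_ray:
  assumes J: "\<And>y. (J has_derivative J' y) (at y)"
    and \<xi>: "\<xi> \<in> tangent_space MB z" "norm \<xi> = 1"
  shows pullback_differentiable:
      "\<And>t. \<bar>t\<bar> < \<Delta> \<Longrightarrow> (\<lambda>s. J (RB (s *\<^sub>R \<xi>))) differentiable at t"
    and deriv_pullback_0:
      "deriv (\<lambda>s. J (RB (s *\<^sub>R \<xi>))) 0 = riemannian_gradient MB J z \<bullet> \<xi>"
proof -
  have \<xi>': "\<xi> \<in> T" "B \<xi> = 0" using \<xi>(1) by (auto simp: tangent_space_constraint_set)
  obtain \<gamma>' where \<gamma>': "\<And>t. norm (t *\<^sub>R \<xi>) < \<Delta> \<Longrightarrow>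
      ((\<lambda>t. RB (t *\<^sub>R \<xi>)) has_vector_derivative \<gamma>' t) (at t)" "\<gamma>' 0 = \<xi>"
    using RB_ray_C1[OF \<xi>'] by (metis (lifting) mem_Collect_eq)
  have D: "((\<lambda>s. J (RB (s *\<^sub>R \<xi>))) has_real_derivative J' (RB (t *\<^sub>R \<xi>)) (\<gamma>' t)) (at t)"
    if "\<bar>t\<bar> < \<Delta>" for t
  proof -
    have "(J \<circ> (\<lambda>s. RB (s *\<^sub>R \<xi>)) has_vector_derivative J' (RB (t *\<^sub>R \<xi>)) (\<gamma>' t)) (at t)"
      using vector_derivative_diff_chain_within[of "\<lambda>s. RB (s *\<^sub>R \<xi>)" "\<gamma>' t" t UNIV J]
        \<gamma>'(1)[of t] that \<xi>(2) has_derivative_at_withinI[OF J] by simp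
    then show ?thesis
      by (simp add: has_real_derivative_iff_has_vector_derivative o_def)
  qed
  show "(\<lambda>s. J (RB (s *\<^sub>R \<xi>))) differentiable at t" if "\<bar>t\<bar> < \<Delta>" for t
    using D[OF that] real_differentiable_def by blast
  have "deriv (\<lambda>s. J (RB (s *\<^sub>R \<xi>))) 0 = J' z \<xi>"
    using DERIV_imp_deriv[OF D[of 0]] radii(1) \<gamma>'(2) by (simp add: RB_0)
  then show "deriv (\<lambda>s. J (RB (s *\<^sub>R \<xi>))) 0 = riemannian_gradient MB J z \<bullet> \<xi>"
    using riemannian_gradient_inner[OF J \<xi>(1)] by simp
qed

end

section \<open>Backtracking line search\<close>

lemma sufficient_decrease_for_small_steps:
  fixes \<phi> :: "real \<Rightarrow> real"
  assumes diff: "\<And>t. 0 \<le> t \<Longrightarrow> t \<le> \<alpha> \<Longrightarrow> \<phi> differentiable at t"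
    and lip: "\<And>t. 0 \<le> t \<Longrightarrow> t \<le> \<alpha> \<Longrightarrow> \<bar>deriv \<phi> t - deriv \<phi> 0\<bar> \<le> \<beta> * t"
    and slope: "deriv \<phi> 0 = - m"
    and \<alpha>: "0 < \<alpha>" "\<beta> * \<alpha> \<le> (1 - cA) * m" and \<beta>: "0 \<le> \<beta>"
  shows "\<phi> \<alpha> \<le> \<phi> 0 - cA * \<alpha> * m"
proof -
  have "DERIV \<phi> t :> deriv \<phi> t" if "0 \<le> t" "t \<le> \<alpha>" for t
    using diff[OF that] by (simp add: DERIV_deriv_iff_real_differentiable)
  then obtain \<tau> where \<tau>: "0 < \<tau>" "\<tau> < \<alpha>" "\<phi> \<alpha> - \<phi> 0 = (\<alpha> - 0) * deriv \<phi> \<tau>"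
    using MVT2[OF \<alpha>(1), of \<phi> "deriv \<phi>"] by blast
  have "deriv \<phi> \<tau> \<le> \<beta> * \<tau> - m" using lip[of \<tau>] \<tau> slope by simp
  also have "\<beta> * \<tau> \<le> \<beta> * \<alpha>" using \<tau> \<beta> by (intro mult_left_mono) auto
  also have "\<dots> \<le> (1 - cA) * m" by (rule \<alpha>(2))
  finally have "deriv \<phi> \<tau> \<le> - cA * m" by (simp add: algebra_simps)
  then have "\<alpha> * deriv \<phi> \<tau> \<le> \<alpha> * (- cA * m)" using \<alpha>(1) by (intro mult_left_mono) auto
  with \<tau>(3) show ?thesis by (simp add: algebra_simps)
qed

text \<open>If the first trial step is rejected, then the accepted step times \<open>1 / \<rho>\<close> was rejected as well, so it
exceeds the threshold \<open>b\<close> below which all steps are accepted.\<close>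

lemma backtracked_step_lower_bound:
  fixes a \<rho> b :: real
  assumes \<rho>: "0 < \<rho>" "\<rho> < 1" and a: "0 < a"
    and accept: "\<And>\<alpha>. 0 < \<alpha> \<Longrightarrow> \<alpha> \<le> a \<Longrightarrow> \<alpha> \<le> b \<Longrightarrow> A \<alpha>"
    and first: "\<forall>i<j. \<not> A (a * \<rho> ^ i)"
  shows "min a (\<rho> * b) \<le> a * \<rho> ^ j"
proof (cases j)
  case (Suc i)
  have "a * \<rho> ^ i \<le> a" using \<rho> a by (simp add: power_le_one)
  moreover have "0 < a * \<rho> ^ i" using \<rho> a by simp
  ultimately have "b < a * \<rho> ^ i" using accept first Suc by (meson lessI not_le)
  then have "\<rho> * b \<le> \<rho> * (a * \<rho> ^ i)" using \<rho> by simp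
  then show ?thesis by (simp add: Suc algebra_simps)
qed simp

text \<open>The values \<open>f\<close> decrease to a limit, so the decrements \<open>cA \<alpha> m\<close> tend to zero; an index with \<open>m \<ge> e\<close> has
a decrement of at least \<open>cA min {a, \<eta> e} e\<close>, which can happen only finitely often.\<close>

lemma slopes_tendsto_0:
  fixes f \<alpha> m :: "nat \<Rightarrow> real"
  assumes decrease: "\<And>k. f (Suc k) \<le> f k - cA * \<alpha> k * m k" and below: "\<And>k. l \<le> f k"
    and pos: "0 < cA" "0 < a" "0 < \<eta>" "\<And>k. 0 \<le> m k"
    and step: "\<And>k. min a (\<eta> * m k) \<le> \<alpha> k"
  shows "m \<longlonglongrightarrow> 0"
proof -
  have \<alpha>: "0 \<le> \<alpha> k" for k
    using step[of k] pos(2,3) pos(4)[of k] by (smt (verit) mult_nonneg_nonneg)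
  have "decseq f"
    using decrease pos(1,4) \<alpha> by (intro decseq_SucI) (smt (verit) mult_nonneg_nonneg)
  then obtain L where "f \<longlonglongrightarrow> L" using decseq_convergent below by metis
  then have "(\<lambda>k. f k - f (Suc k)) \<longlonglongrightarrow> L - L" by (intro tendsto_diff LIMSEQ_Suc)
  then have lim: "(\<lambda>k. f k - f (Suc k)) \<longlonglongrightarrow> 0" by simp
  show ?thesis
  proof (rule LIMSEQ_I)
    fix e :: real assume "e > 0"
    define e' where "e' = cA * (min a (\<eta> * e) * e)"
    have "e' > 0" using \<open>e > 0\<close> pos by (simp add: e'_def)
    then obtain k0 where k0: "\<And>k. k \<ge> k0 \<Longrightarrow> norm (f k - f (Suc k) - 0) < e'"
      using LIMSEQ_D[OF lim] by blast
    have "m k < e" if "k \<ge> k0" for k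
    proof (rule ccontr)
      assume "\<not> m k < e"
      then have "e \<le> m k" by simp
      then have "min a (\<eta> * e) \<le> min a (\<eta> * m k)" using pos by (intro min.mono) auto
      also have "\<dots> \<le> \<alpha> k" by (rule step)
      finally have "min a (\<eta> * e) * e \<le> \<alpha> k * m k"
        using \<open>e \<le> m k\<close> \<open>e > 0\<close> \<alpha> by (intro mult_mono) auto
      then have "e' \<le> cA * \<alpha> k * m k"
        using pos(1) unfolding e'_def by simp
      then show False using decrease[of k] k0[OF that] by simp
    qed
    then show "\<exists>no. \<forall>n\<ge>no. norm (m n - 0) < e" using pos(4) by (intro exI[of _ k0]) auto
  qed
qed

section \<open>Convergence of the line search\<close>

text \<open>The two terms in \<open>\<Delta> + KP b r\<close> contribute \<open>\<sigma>/2\<close> each to the second bound and \<open>1/4\<close>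
each to the third.  Division by zero yields \<open>0\<close>, so \<open>\<Delta> > 0\<close> forces \<open>KP\<close>, \<open>KL\<close> and \<open>b\<close> to be positive.\<close>

lemma trust_radii_suffice:
  fixes KP KL K1 K2 \<sigma> b r \<Delta> :: real
  assumes nonneg: "0 \<le> KP" "0 \<le> KL" "0 \<le> b" and pos: "0 < K1" "0 < K2"
    and r: "r = min (\<sigma> / (2 * KP * b)) (1 / (4 * K2 * KL * KP\<^sup>2 * b ^ 3))"
    and \<Delta>: "\<Delta> = Min {\<sigma> / 2, 1 / (4 * K2 * KL * KP * b\<^sup>2), r / (2 * K1 * KL * b)}" "0 < \<Delta>"
  shows "0 \<le> r" "\<Delta> + KP * b * r \<le> \<sigma>"
    "KL * b * (K2 * (\<Delta> + KP * b * r)) * (KP * b) \<le> 1/2"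
    "KL * b * (K1 * \<Delta>) \<le> r / 2"
proof -
  have \<Delta>_le: "\<Delta> \<le> \<sigma> / 2" "\<Delta> \<le> 1 / (4 * K2 * KL * KP * b\<^sup>2)" "\<Delta> \<le> r / (2 * K1 * KL * b)"
    unfolding \<Delta>(1) by simp_all
  have "0 < 1 / (4 * K2 * KL * KP * b\<^sup>2)" using \<Delta>_le \<Delta>(2) by linarith
  then have "4 * K2 * KL * KP * b\<^sup>2 \<noteq> 0" by (metis div_by_0 less_irrefl)
  then have p: "0 < KP" "0 < KL" "0 < b" using nonneg by auto
  have "0 < r / (2 * K1 * KL * b)" using \<Delta>_le \<Delta>(2) by linarith
  moreover have "0 < 2 * K1 * KL * b" using p pos by simp
  ultimately have "0 < r" by (meson divide_nonpos_pos not_le)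
  then show "0 \<le> r" by simp
  have "r \<le> \<sigma> / (2 * KP * b)" "r \<le> 1 / (4 * K2 * KL * KP\<^sup>2 * b ^ 3)" unfolding r by simp_all
  then have r_le: "KP * b * r \<le> \<sigma> / 2" "K2 * KL * KP\<^sup>2 * b ^ 3 * r \<le> 1 / 4"
    using p pos by (simp_all add: field_simps)
  have \<Delta>_le': "K2 * KL * KP * b\<^sup>2 * \<Delta> \<le> 1/4" "KL * b * (K1 * \<Delta>) \<le> r / 2"
    using p pos \<Delta>_le by (simp_all add: field_simps)
  show "\<Delta> + KP * b * r \<le> \<sigma>" using \<Delta>_le(1) r_le(1) by linarith
  show "KL * b * (K1 * \<Delta>) \<le> r / 2" by (rule \<Delta>_le'(2))
  have "KL * b * (K2 * (\<Delta> + KP * b * r)) * (KP * b)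
      = K2 * KL * KP * b\<^sup>2 * \<Delta> + K2 * KL * KP\<^sup>2 * b ^ 3 * r"
    by (simp add: algebra_simps power2_eq_square power3_eq_cube)
  then show "KL * b * (K2 * (\<Delta> + KP * b * r)) * (KP * b) \<le> 1/2"
    using r_le(2) \<Delta>_le'(1) by linarith
qed

theorem theorem7p1:
  fixes M MB X :: "'e::{real_inner,banach} set"
    and B :: "'e \<Rightarrow>\<^sub>L 'y::{real_inner,banach}" and c :: 'y
    and P :: "'e \<Rightarrow> 'e \<Rightarrow>\<^sub>L 'e"
    and R :: "'e \<Rightarrow> 'e \<Rightarrow> 'e"
    and DR :: "'e \<Rightarrow> 'e \<Rightarrow> 'e \<Rightarrow>\<^sub>L 'e"
    and D2R :: "'e \<Rightarrow> 'e \<Rightarrow> 'e \<Rightarrow>\<^sub>L 'e \<Rightarrow>\<^sub>L 'e"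
    and J :: "'e \<Rightarrow> real"
    and RB :: "'e \<Rightarrow> 'e \<Rightarrow> 'e"
    and KP KL \<sigma> K1 K2 r \<Delta>s \<Delta>RL \<beta>RL abar \<rho> cA Ka :: real
    and x0 :: 'e and x d :: "nat \<Rightarrow> 'e"
  assumes Y_nonzero: "\<exists>y::'y. y \<noteq> 0"
    and M_manifold: "C2_embedded_submanifold M"
    and B_surj: "surj (blinfun_apply B)"
    and MB_eq: "MB = {z\<in>M. B z = c}"
    and MB_nonempty: "MB \<noteq> {}"
    and P_proj: "\<forall>z\<in>M. range (blinfun_apply (P z)) = tangent_space M z \<and>
                   (\<forall>w. P z (P z w) = P z w)"
    and R_into: "\<forall>z\<in>M. \<forall>u\<in>tangent_space M z. R z u \<in> M"
    and R_C2: "\<forall>z\<in>M. has_C2_derivs (tangent_space M z) (R z) (DR z) (D2R z)"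
    and R_0: "\<forall>z\<in>M. R z 0 = z"
    and DR_0: "\<forall>z\<in>M. \<forall>w\<in>tangent_space M z. DR z 0 w = w"
    and D2R_0: "\<forall>S\<subseteq>M. bounded S \<longrightarrow> (\<exists>K. \<forall>z\<in>S.
                  \<forall>w1\<in>tangent_space M z. \<forall>w2\<in>tangent_space M z.
                    norm (D2R z 0 w1 w2) \<le> K * norm w1 * norm w2)"
    and A1: "\<forall>S\<subseteq>MB. bounded S \<longrightarrow>
               (\<exists>C>0. \<forall>z\<in>S. \<forall>\<delta>. L_op B P z \<delta> \<bullet> \<delta> \<ge> C * (norm \<delta>)\<^sup>2)"
    and A2_cont: "continuous_on M P"
    and A2_bdd: "\<forall>S\<subseteq>M. bounded S \<longrightarrow> bounded (P ` S)"
    and A3: "\<forall>S\<subseteq>M. bounded S \<longrightarrow> (\<exists>\<sigma> K1 K2. retraction_bounds M DR D2R S \<sigma> K1 K2)"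
    and J_C2: "C2_on UNIV J"
    and J_below: "bdd_below (range J)"
    and J_coercive: "\<forall>a. bounded {z. J z \<le> a}"
    and J_grad: "\<forall>S. bounded S \<longrightarrow> bounded (gradient J ` S)"
    and J_hess: "\<forall>S. bounded S \<longrightarrow> bounded (hessian J ` S)"
    and x0: "x0 \<in> MB"
    and X_eq: "X = {z\<in>MB. J z \<le> J x0}"
    and KP: "\<forall>z\<in>X. norm (P z) \<le> KP"
    and KL: "\<forall>z\<in>X. onorm (inv (L_op B P z)) \<le> KL"
    and bounds_X: "retraction_bounds M DR D2R X \<sigma> K1 K2"
    and r_eq: "r = min (\<sigma> / (2 * KP * norm B)) (1 / (4 * K2 * KL * KP\<^sup>2 * norm B ^ 3))"
    and \<Delta>s_eq: "\<Delta>s = Min {\<sigma> / 2, 1 / (4 * K2 * KL * KP * (norm B)\<^sup>2), r / (2 * K1 * KL * norm B)}"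
    and RB_eq: "RB = constrained_retraction B c P R r"
    and \<Delta>RL: "0 < \<Delta>RL" "\<Delta>RL < \<Delta>s"
    and \<beta>RL: "0 < \<beta>RL"
    and RL: "\<forall>z\<in>X. \<forall>\<xi>\<in>tangent_space MB z. norm \<xi> = 1 \<longrightarrow> (\<forall>t\<in>{0..\<Delta>RL}.
               \<bar>deriv (\<lambda>s. J (RB z (s *\<^sub>R \<xi>))) t - deriv (\<lambda>s. J (RB z (s *\<^sub>R \<xi>))) 0\<bar> \<le> \<beta>RL * t)"
    and abar: "abar > 0"
    and \<rho>: "0 < \<rho>" "\<rho> < 1"
    and cA: "0 < cA" "cA < 1"
    and iterates: "line_search_iterates MB J RB (\<lambda>k. min abar \<Delta>RL) \<rho> cA x0 x d"
    and Ka: "Ka > 0"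
    and angle: "\<forall>k. d k \<bullet> riemannian_gradient MB J (x k)
                  \<ge> Ka * norm (riemannian_gradient MB J (x k))"
  shows "(\<lambda>k. norm (riemannian_gradient MB J (x k))) \<longlonglongrightarrow> 0"
proof -
  obtain J' where J': "\<And>y. (J has_derivative blinfun_apply (J' y)) (at y)"
    using J_C2 unfolding C2_on_def has_C2_derivs_def by auto
  have signs: "0 < K1" "0 < K2" using bounds_X by (auto simp: retraction_bounds_def)
  have at_X: "\<exists>C. constrained_retraction_at M B c P R DR D2R z C KP KL \<sigma> K1 K2 r \<Delta>s"
    if z: "z \<in> X" for z
  proof -
    have zM: "z \<in> M" "z \<in> MB" "B z = c" using z by (auto simp: X_eq MB_eq)
    obtain C where C: "C > 0" "\<And>\<delta>. L_op B P z \<delta> \<bullet> \<delta> \<ge> C * (norm \<delta>)\<^sup>2"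
      using A1[rule_format, of "{z}"] zM by auto
    have "bounded_linear (L_op B P z)"
      unfolding L_op_def
      by (intro bounded_linear_compose[OF blinfun.bounded_linear_right]
          bounded_linear_adjoint_Hilbert)
    then have "bounded_linear (inv (L_op B P z))" using C by (rule coercive_operator_invertible)
    then have "0 \<le> KL" using KL z onorm_pos_le order_trans by blast
    moreover have "0 \<le> KP" using KP z norm_ge_zero order_trans by blast
    ultimately have radii: "0 \<le> r" "\<Delta>s + KP * norm B * r \<le> \<sigma>"
      "KL * norm B * (K2 * (\<Delta>s + KP * norm B * r)) * (KP * norm B) \<le> 1/2"
      "KL * norm B * (K1 * \<Delta>s) \<le> r / 2"
      using trust_radii_suffice[OF _ _ _ signs r_eq \<Delta>s_eq] \<Delta>RL by simp_all
    have "constrained_retraction_at M B c P R DR D2R z C KP KL \<sigma> K1 K2 r \<Delta>s"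
    proof
      show "retraction_bounds M DR D2R {z} \<sigma> K1 K2"
        using bounds_X z by (auto simp: retraction_bounds_def)
    qed (use zM C radii z \<Delta>RL P_proj R_into R_C2 R_0 DR_0 KP KL in auto)
    then show ?thesis by blast
  qed

  define m where "m k = riemannian_gradient MB J (x k) \<bullet> d k" for k
  define a where "a = min abar \<Delta>RL"
  have a: "0 < a" "a \<le> \<Delta>RL" using abar \<Delta>RL by (auto simp: a_def)
  have m_pos: "m k > 0" and d: "d k \<in> tangent_space MB (x k)" "norm (d k) = 1" for k
    using iterates by (auto simp: line_search_iterates_def m_def)
  have "\<forall>k. \<exists>j. armijo MB J RB cA (x k) (d k) (a * \<rho> ^ j) \<and>
      (\<forall>i<j. \<not> armijo MB J RB cA (x k) (d k) (a * \<rho> ^ i)) \<and>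
      x (Suc k) = RB (x k) (- ((a * \<rho> ^ j) *\<^sub>R d k))"
    using iterates by (simp add: line_search_iterates_def a_def)
  then obtain j where j: "\<And>k. armijo MB J RB cA (x k) (d k) (a * \<rho> ^ j k)"
    "\<And>k. \<forall>i<j k. \<not> armijo MB J RB cA (x k) (d k) (a * \<rho> ^ i)"
    "\<And>k. x (Suc k) = RB (x k) (- ((a * \<rho> ^ j k) *\<^sub>R d k))"
    by metis
  define \<alpha> where "\<alpha> k = a * \<rho> ^ j k" for k
  have \<alpha>: "0 < \<alpha> k" "\<alpha> k \<le> a" for k
    using a(1) \<rho> by (auto simp: \<alpha>_def power_le_one)
  have decrease: "J (x (Suc k)) \<le> J (x k) - cA * \<alpha> k * m k" for k
    using j(1)[of k] unfolding armijo_def j(3) \<alpha>_def m_def .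

  \<comment> \<open>Monotone decrease keeps the iterates in the sublevel set, where all bounds hold.\<close>
  have in_X: "x k \<in> X" for k
  proof (induction k)
    case 0
    then show ?case using iterates x0 by (simp add: line_search_iterates_def X_eq)
  next
    case (Suc k)
    obtain C where "constrained_retraction_at M B c P R DR D2R (x k) C KP KL \<sigma> K1 K2 r \<Delta>s"
      using at_X[OF Suc.IH] by blast
    then interpret cr: constrained_retraction_at M B c P R DR D2R "x k" C KP KL \<sigma> K1 K2 r \<Delta>s .
    have "d k \<in> cr.T" "B (d k) = 0"
      using d(1)[of k] by (auto simp: MB_eq cr.tangent_space_constraint_set)
    then have "cr.RB (- (\<alpha> k *\<^sub>R d k)) \<in> MB"
      unfolding MB_eq using d(2)[of k] \<alpha>[of k] a \<Delta>RL
      by (intro cr.RB_in_constraint_set)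
        (auto simp: subspace_neg subspace_mul cr.subspace_T blinfun.bilinear_simps)
    then have "x (Suc k) \<in> MB" by (simp add: j(3) \<alpha>_def RB_eq cr.RB_def)
    moreover have "0 \<le> cA * \<alpha> k * m k" using cA(1) \<alpha>(1)[of k] m_pos[of k] by simp
    then have "J (x (Suc k)) \<le> J x0" using decrease[of k] Suc.IH by (simp add: X_eq)
    ultimately show ?case by (simp add: X_eq)
  qed

  have step: "min a (\<rho> * ((1 - cA) / \<beta>RL) * m k) \<le> \<alpha> k" for k
  proof -
    obtain C where "constrained_retraction_at M B c P R DR D2R (x k) C KP KL \<sigma> K1 K2 r \<Delta>s"
      using at_X[OF in_X] by blast
    then interpret cr: constrained_retraction_at M B c P R DR D2R "x k" C KP KL \<sigma> K1 K2 r \<Delta>s .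
    define \<phi> where "\<phi> s = J (RB (x k) (s *\<^sub>R (- d k)))" for s
    have RB: "RB (x k) v = cr.RB v" for v by (simp add: RB_eq cr.RB_def)
    have \<xi>: "- d k \<in> tangent_space cr.MB (x k)" "norm (- d k) = 1"
      using d[of k] by (auto simp: MB_eq cr.tangent_space_constraint_set subspace_neg cr.subspace_T
          blinfun.minus_right)
    have "armijo MB J RB cA (x k) (d k) t" if t: "0 < t" "t \<le> a" "t \<le> (1 - cA) / \<beta>RL * m k" for t
    proof -
      have "\<phi> t \<le> \<phi> 0 - cA * t * m k"
      proof (rule sufficient_decrease_for_small_steps[where \<beta> = \<beta>RL])
        show "\<phi> differentiable at s" if "0 \<le> s" "s \<le> t" for s
          unfolding \<phi>_def RB using that t a \<Delta>RL
          by (intro cr.pullback_differentiable[OF J' \<xi>]) auto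
        show "\<bar>deriv \<phi> s - deriv \<phi> 0\<bar> \<le> \<beta>RL * s" if "0 \<le> s" "s \<le> t" for s
          using RL[THEN bspec, OF in_X, THEN bspec, of "- d k" k] \<xi> that t a
          unfolding \<phi>_def[abs_def] by (simp add: MB_eq)
        show "deriv \<phi> 0 = - m k"
          using cr.deriv_pullback_0[OF J' \<xi>] unfolding \<phi>_def[abs_def] RB by (simp add: m_def MB_eq)
        show "\<beta>RL * t \<le> (1 - cA) * m k" using t(3) \<beta>RL by (simp add: field_simps)
      qed (use t \<beta>RL in auto)
      then show ?thesis
        unfolding \<phi>_def armijo_def using RB[of 0] by (simp add: m_def cr.RB_0)
    qed
    then have "min a (\<rho> * ((1 - cA) / \<beta>RL * m k)) \<le> a * \<rho> ^ j k"
      by (rule backtracked_step_lower_bound[OF \<rho> a(1) _ j(2)])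
    then show ?thesis by (simp add: \<alpha>_def mult.assoc)
  qed

  obtain l where l: "\<And>k. l \<le> J (x k)" using J_below by (meson bdd_below.E rangeI)
  have "0 < \<rho> * ((1 - cA) / \<beta>RL)" using \<rho> cA \<beta>RL by simp
  then have "m \<longlonglongrightarrow> 0"
    using slopes_tendsto_0[where f = "\<lambda>k. J (x k)", OF decrease l cA(1) a(1) _ _ step] m_pos
    by (simp add: less_imp_le)
  then have lim: "(\<lambda>k. m k / Ka) \<longlonglongrightarrow> 0" by (rule tendsto_divide_zero)
  show ?thesis
  proof (rule tendsto_sandwich[OF _ _ tendsto_const lim])
    show "\<forall>\<^sub>F k in sequentially. norm (riemannian_gradient MB J (x k)) \<le> m k / Ka"
      using angle Ka by (simp add: m_def inner_commute field_simps)
  qed simp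
qed

end
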